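(* Let $a$ be a boundary point of a $\mathbb C$-convex domain $D\subset\mathbb C^n$. (i) Then $\lim_{z\to a}\gamma_D(z;X)=\infty$ locally uniformly in $X\notin L_a$; that is, for any $X\in\mathbb C^n\setminus L_a$ and any $M>0$ there are neighborhoods $U$ of $a$ and $V$ of $X$ such that $\gamma_D(z;Y)>M$ for any $z\in D\cap U$ and any $Y\in V\setminus L_a$. (ii) If $\partial D$ is $C^1$-smooth at $a$, then $L_a$ is a (complex) linear space. Moreover, for any non-tangential cone $\Lambda$ with vertex at $a$ there is a constant $c>0$ such that $$\limsup_{\Lambda\ni z\to a}\kappa_D(z;X)\le c$$ locally uniformly in the unit vectors $X\in L_a$.
   Context: A domain $D\subset\mathbb C^n$ is $\mathbb C$-convex if every non-empty intersection of $D$ with a complex (affine) line is a simply connected domain (in particular connected). For $a\in\partial D$, $L_a$ is the set of all vectors $X\in\mathbb C^n$ for which there exists $\varepsilon>0$ such that $\{a+\lambda X:\lambda\in\mathbb C,\ |\lambda|<\varepsilon\}\subset\partial D$ (so $0\in L_a$). Let $\mathbb D\subset\mathbb C$ be the unit disc and $\mathcal O(A,B)$ the set of holomorphic maps $A\to B$. The Carathéodory (pseudo)metric is $\gamma_D(z;X)=\sup\{|f'(z)X|: f\in\mathcal O(D,\mathbb D),\ f(z)=0\}$; the Kobayashi (pseudo)metric is $\kappa_D(z;X)=\inf\{\alpha\ge0:\exists\varphi\in\mathcal O(\mathbb D,D):\varphi(0)=z,\ \alpha\varphi'(0)=X\}$. "$C^1$-smooth at $a$" means that $\partial D$ is a $C^1$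 hypersurface (with a $C^1$ local defining function of $D$ with non-vanishing gradient) in a neighborhood of $a$. A non-tangential cone with vertex $a$ is a set $\Lambda=\{a+v: \operatorname{Re}\langle v,\nu\rangle\ge\theta\|v\|\}$ with $\theta\in(0,1)$, where $\nu$ is the inner unit normal to $\partial D$ at $a$; the $\limsup$ is taken over $z\in D\cap\Lambda$. "Locally uniformly" in (ii) means: for every unit vector $X_0\in L_a$ and every $\varepsilon>0$ there are neighborhoods $U$ of $a$ and $V$ of $X_0$ such that $\kappa_D(z;X)\le c+\varepsilon$ for all $z\in D\cap\Lambda\cap U$ and all unit vectors $X\in V\cap L_a$. *)

theory Defs
  imports "HOL-Complex_Analysis.Complex_Analysis"
begin

definition complex_line :: "complex^'n \<Rightarrow> complex^'n \<Rightarrow> (complex^'n) set" where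
  "complex_line p v = {p + c *s v |c. True}"

definition C_convex_domain :: "(complex^'n) set \<Rightarrow> bool" where
  "C_convex_domain D \<longleftrightarrow> open D \<and> connected D \<and> D \<noteq> {} \<and>
     (\<forall>p v. v \<noteq> 0 \<longrightarrow> D \<inter> complex_line p v \<noteq> {} \<longrightarrow> simply_connected (D \<inter> complex_line p v))"

definition boundary_disc_directions :: "(complex^'n) set \<Rightarrow> complex^'n \<Rightarrow> (complex^'n) set" where
  "boundary_disc_directions D a =
     {X. \<exists>\<epsilon>>0. {a + c *s X |c. norm c < \<epsilon>} \<subseteq> frontier D}"

text \<open>The library's \<open>holomorphic_on\<close> covers one complex variable only. In several variables a map
  on an open set is holomorphic iff its real Frechet derivative exists and is complex linear
  (additivity is part of \<open>has_derivative\<close>).\<close>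

definition holomorphic_fun_on :: "(complex^'n \<Rightarrow> complex) \<Rightarrow> (complex^'n) set \<Rightarrow> bool" where
  "holomorphic_fun_on f D \<longleftrightarrow>
     (\<forall>z\<in>D. \<exists>f'. (f has_derivative f') (at z) \<and> (\<forall>c v. f' (c *s v) = c * f' v))"

definition holomorphic_disc :: "(complex \<Rightarrow> complex^'n) \<Rightarrow> bool" where
  "holomorphic_disc \<phi> \<longleftrightarrow> (\<forall>i. (\<lambda>\<zeta>. \<phi> \<zeta> $ i) holomorphic_on ball 0 1)"

text \<open>Both metrics take extended real values, so that \<open>Sup\<close> and \<open>Inf\<close> are meaningful without
  boundedness or non-emptiness side conditions.\<close>

definition caratheodory_metric ::
  "(complex^'n) set \<Rightarrow> complex^'n \<Rightarrow> complex^'n \<Rightarrow> ereal" where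
  "caratheodory_metric D z X =
     Sup {ereal (norm (frechet_derivative f (at z) X)) |f.
            holomorphic_fun_on f D \<and> f ` D \<subseteq> ball 0 1 \<and> f z = 0}"

definition kobayashi_metric ::
  "(complex^'n) set \<Rightarrow> complex^'n \<Rightarrow> complex^'n \<Rightarrow> ereal" where
  "kobayashi_metric D z X =
     Inf {ereal \<alpha> |\<alpha>. \<alpha> \<ge> 0 \<and>
            (\<exists>\<phi>. holomorphic_disc \<phi> \<and> \<phi> ` ball 0 1 \<subseteq> D \<and> \<phi> 0 = z \<and>
                 \<alpha> *\<^sub>R (\<chi> i. deriv (\<lambda>\<zeta>. \<phi> \<zeta> $ i) 0) = X)}"

text \<open>Here \<open>g\<close> is the gradient of \<open>r\<close> for the real inner product of \<open>complex^'n\<close>, i.e. the real part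
  of the Hermitian one. As \<open>g\<close> does not vanish on \<open>U\<close>, the boundary of \<open>D\<close> in \<open>U\<close> is \<open>{r = 0}\<close>.\<close>

definition C1_defining_function ::
  "(complex^'n) set \<Rightarrow> (complex^'n) set \<Rightarrow> (complex^'n \<Rightarrow> real) \<Rightarrow> (complex^'n \<Rightarrow> complex^'n) \<Rightarrow> bool"
  where
  "C1_defining_function D U r g \<longleftrightarrow>
     open U \<and> D \<inter> U = {z\<in>U. r z < 0} \<and> continuous_on U g \<and>
     (\<forall>z\<in>U. (r has_derivative (\<lambda>v. g z \<bullet> v)) (at z) \<and> g z \<noteq> 0)"

definition C1_smooth_at :: "(complex^'n) set \<Rightarrow> complex^'n \<Rightarrow> bool" where
  "C1_smooth_at D a \<longleftrightarrow> (\<exists>U r g. a \<in> U \<and> C1_defining_function D U r g)"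

definition inner_unit_normal :: "(complex^'n) set \<Rightarrow> complex^'n \<Rightarrow> complex^'n \<Rightarrow> bool" where
  "inner_unit_normal D a \<nu> \<longleftrightarrow>
     (\<exists>U r g. a \<in> U \<and> C1_defining_function D U r g \<and> \<nu> = - (g a /\<^sub>R norm (g a)))"

definition nontangential_cone :: "complex^'n \<Rightarrow> complex^'n \<Rightarrow> real \<Rightarrow> (complex^'n) set" where
  "nontangential_cone a \<nu> \<theta> = {a + v |v. v \<bullet> \<nu> \<ge> \<theta> * norm v}"

end

theory Submission
  imports Defs
begin

text \<open>
  Any point of \<open>D\<close> is joined to a base point by a simply connected line slice of \<open>D\<close>, so branches of
  the logarithm of a zero-free complex affine function can be continued along these slices and give
  a continuous logarithm on all of \<open>D\<close>.

  This yields first that through every \<open>a \<notin> D\<close> there passes a complex hyperplane missing \<open>D\<close>. Take a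
  maximal complex subspace \<open>W\<close> such that \<open>a + W\<close> misses \<open>D\<close>. If its codimension were at least two,
  there would be coordinates \<open>(x, y)\<close> modulo \<open>W\<close> in which every complex line \<open>y = t x\<close>, and also
  \<open>x = 0\<close>, meets \<open>D\<close>. The parts of \<open>D\<close> over the lines \<open>y = t x\<close> carry branches of \<open>log x\<close>, and as the
  parameter \<open>t\<close> ranges over a contractible set these can be chosen continuously in \<open>t\<close>. The resulting
  logarithm contradicts the winding of \<open>x\<close> along a small loop around a point of \<open>D\<close> with \<open>x = 0\<close>.

  Secondly, let \<open>d\<close> be the distance from \<open>z \<in> D\<close> to the complement of \<open>D\<close> in direction \<open>X\<close>, let \<open>l\<close> be
  affine with \<open>{l = 0}\<close> a hyperplane missing \<open>D\<close> through the nearest exit point, and let \<open>h\<close> be a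
  holomorphic square root of \<open>l\<close>. It is constant on the fibres of \<open>l\<close>, so it omits \<open>- h z'\<close> for all \<open>z'\<close>
  in the disc of radius \<open>d\<close> about \<open>z\<close>, and the Caratheodory metric at \<open>(z; X)\<close> is at least
  \<open>1 / (32 d)\<close>. Part (i) follows since \<open>d\<close> tends to \<open>0\<close> for directions outside \<open>L\<^sub>a\<close>. For (ii), the \<open>C\<^sup>1\<close>
  condition allows boundary discs to be pushed into \<open>D\<close> along the cone. As the Caratheodory metric is
  a seminorm in \<open>X\<close>, its comparison with \<open>1 / d\<close> transfers the resulting bounds from a basis of \<open>L\<^sub>a\<close>
  to all unit vectors of \<open>L\<^sub>a\<close>, and the Kobayashi metric is at most \<open>1 / d\<close>.
\<close>

subsection \<open>Continuing logarithms along complex lines\<close>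

lemma norm_vector_scalar_mult: "norm (c *s (x::complex^'n)) = norm c * norm x"
  by (simp add: norm_vec_def norm_mult L2_set_right_distrib)

lemma continuous_on_vector_scalar_mult [continuous_intros]:
  fixes g :: "'a::topological_space \<Rightarrow> complex^'n"
  assumes "continuous_on S f" "continuous_on S g"
  shows "continuous_on S (\<lambda>x. f x *s g x)"
  unfolding vector_scalar_mult_def
  by (intro continuous_on_vec_lambda continuous_intros assms)

text \<open>The difference takes values in the discrete set of multiples of
  \<open>2 * pi * \<i>\<close>, so continuity makes it constant on a connected set. This is the
  uniqueness of logarithm branches used throughout.\<close>

lemma exp_eq_imp_diff_constant:
  fixes h1 h2 :: "'a::topological_space \<Rightarrow> complex"
  assumes "connected S" "continuous_on S h1" "continuous_on S h2"
    and eq: "\<And>x. x \<in> S \<Longrightarrow> exp (h1 x) = exp (h2 x)"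
    and xy: "x \<in> S" "y \<in> S"
  shows "h1 x - h2 x = h1 y - h2 y"
proof -
  have int: "\<exists>n::int. h1 x - h2 x = of_int (2 * n) * pi * \<i>" if "x \<in> S" for x
    using eq[OF that] unfolding exp_eq by (auto simp: algebra_simps)
  have "(\<lambda>x. h1 x - h2 x) constant_on S"
  proof (rule continuous_discrete_range_constant)
    show "\<exists>e>0. \<forall>y. y \<in> S \<and> h1 y - h2 y \<noteq> h1 x - h2 x \<longrightarrow> e \<le> norm ((h1 y - h2 y) - (h1 x - h2 x))"
      if xS: "x \<in> S" for x
    proof (intro exI[of _ "2 * pi"] conjI allI impI)
      fix y assume y: "y \<in> S \<and> h1 y - h2 y \<noteq> h1 x - h2 x"
      obtain n m :: int where n: "h1 y - h2 y = of_int (2 * n) * pi * \<i>" 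
        and m: "h1 x - h2 x = of_int (2 * m) * pi * \<i>"
        using int[OF xS] int[of y] y by blast
      have "(h1 y - h2 y) - (h1 x - h2 x) = of_int (2 * (n - m)) * pi * \<i>"
        unfolding n m by (simp add: algebra_simps)
      then have "norm ((h1 y - h2 y) - (h1 x - h2 x)) = 2 * pi * \<bar>real_of_int (n - m)\<bar>"
        by (simp only: norm_mult norm_of_real abs_mult of_int_mult) simp
      moreover have "n \<noteq> m" using n m y by auto
      then have "1 \<le> \<bar>n - m\<bar>" by linarith
      then have "1 \<le> \<bar>real_of_int (n - m)\<bar>" by linarith
      ultimately show "2 * pi \<le> norm ((h1 y - h2 y) - (h1 x - h2 x))"
        using pi_gt_zero by simp
    qed simp
  qed (use assms in \<open>auto intro!: continuous_intros\<close>)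
  with xy show ?thesis by (auto simp: constant_on_def)
qed

text \<open>The slice lives in the parameter plane, where topology in one complex variable applies.
  The direction \<open>0\<close> is allowed, since continuation from a base point to itself produces
  it.\<close>

definition line_slice :: "(complex^'n) set \<Rightarrow> complex^'n \<Rightarrow> complex^'n \<Rightarrow> complex set" where
  "line_slice D p v = {c. p + c *s v \<in> D}"

lemma continuous_on_line: "continuous_on S (\<lambda>c. p + c *s (v::complex^'n))"
  by (intro continuous_intros)

lemma open_line_slice:
  assumes "open D"
  shows "open (line_slice D p v)"
proof -
  have "line_slice D p v = (\<lambda>c. p + c *s v) -` D"
    by (auto simp: line_slice_def)
  then show ?thesis
    using open_vimage[OF assms continuous_on_line[of UNIV p v]] by simp
qed

lemma simply_connected_line_slice:
  assumes D: "C_convex_domain D"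
  shows "simply_connected (line_slice D p v)"
proof (cases "v = 0")
  case True
  then have "line_slice D p v = (if p \<in> D then UNIV else {})"
    by (auto simp: line_slice_def)
  then show ?thesis
    by (simp add: convex_imp_simply_connected)
next
  case False
  then obtain k where k: "v $ k \<noteq> 0"
    by (metis vec_eq_iff zero_index)
  have "homeomorphism (line_slice D p v) (D \<inter> complex_line p v)
          (\<lambda>c. p + c *s v) (\<lambda>z. (z $ k - p $ k) / v $ k)"
    by (rule homeomorphismI) (use k in \<open>auto simp: line_slice_def complex_line_def intro!: continuous_intros\<close>)
  then have hom: "line_slice D p v homeomorphic (D \<inter> complex_line p v)"
    by (auto simp: homeomorphic_def)
  have "simply_connected (D \<inter> complex_line p v)"
    using D False by (cases "D \<inter> complex_line p v = {}") (auto simp: C_convex_domain_def)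
  with hom show ?thesis
    using homeomorphic_simply_connected_eq by blast
qed

text \<open>\<open>A z\<close> is the value at parameter 1 of the branch on the slice through
  \<open>p z\<close> and \<open>z\<close> that equals \<open>L\<close> at parameter 0. Continuity
  holds because a compact path in one slice stays in all nearby slices. The base point may move with
  \<open>z\<close> as long as \<open>l\<close> has the same value there; a constant \<open>p\<close>
  gives a logarithm on all of \<open>D\<close>.\<close>

lemma continuous_log_along_lines:
  fixes D :: "(complex^'n) set" and p :: "complex^'n \<Rightarrow> complex^'n"
  assumes D: "C_convex_domain D"
    and p: "continuous_on Z p" "\<And>z. z \<in> Z \<Longrightarrow> p z \<in> D" and Z: "Z \<subseteq> D"
    and l: "bounded_linear (l :: complex^'n \<Rightarrow> complex)"
    and nz: "\<And>z c. z \<in> Z \<Longrightarrow> c \<in> line_slice D (p z) (z - p z) \<Longrightarrow> l (p z + c *s (z - p z) - a) \<noteq> 0"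
    and L: "\<And>z. z \<in> Z \<Longrightarrow> exp L = l (p z - a)"
  obtains A where "continuous_on Z A" "\<And>z. z \<in> Z \<Longrightarrow> exp (A z) = l (z - a)"
proof -
  define m where "m = (\<lambda>z c. p z + c *s (z - p z))"
  define S where "S = (\<lambda>z. line_slice D (p z) (z - p z))"
  have mD: "m z c \<in> D \<longleftrightarrow> c \<in> S z" for z c
    by (simp add: m_def S_def line_slice_def)
  have m0: "m z 0 = p z" and m1: "m z 1 = z" for z
    by (simp_all add: m_def)
  have cl: "continuous_on X l" for X
    using l by (rule linear_continuous_on)
  have contm: "continuous_on X (m z)" for X z
    unfolding m_def by (rule continuous_on_line)
  have ex: "\<exists>h. continuous_on (S z) h \<and> h 0 = L \<and> (\<forall>c\<in>S z. exp (h c) = l (m z c - a))"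
    if z: "z \<in> Z" for z
  proof -
    have S: "simply_connected (S z)" "locally path_connected (S z)"
      using D by (simp_all add: S_def simply_connected_line_slice open_line_slice
          open_imp_locally_path_connected C_convex_domain_def)
    have "continuous_on (S z) (\<lambda>c. l (m z c - a))"
      by (rule continuous_on_compose2[OF cl[of UNIV]]) (auto intro!: continuous_intros contm)
    moreover have "l (m z c - a) \<noteq> 0" if "c \<in> S z" for c
      using nz[OF z] that by (simp add: S_def m_def)
    ultimately obtain g where g: "continuous_on (S z) g" "\<And>c. c \<in> S z \<Longrightarrow> l (m z c - a) = exp (g c)"
      using continuous_logarithm_on_simply_connected[OF _ S] by blast
    \<comment> \<open>A branch on the slice is shifted by a multiple of \<open>2 * pi * \<i>\<close>
      so that it starts at \<open>L\<close>.\<close>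
    have "0 \<in> S z"
      using p(2)[OF z] by (simp add: S_def line_slice_def)
    then have "exp (g 0) = exp L"
      using g(2)[of 0] L[OF z] by (simp add: m0)
    then have "exp (L - g 0) = 1"
      by (simp add: exp_diff)
    then have "exp (g c + (L - g 0)) = exp (g c)" for c
      by (simp add: exp_add)
    then show ?thesis
      using g by (intro exI[of _ "\<lambda>c. g c + (L - g 0)"]) (auto intro!: continuous_intros)
  qed
  then obtain h where h: "\<And>z. z \<in> Z \<Longrightarrow> continuous_on (S z) (h z)" "\<And>z. z \<in> Z \<Longrightarrow> h z 0 = L"
      "\<And>z c. z \<in> Z \<Longrightarrow> c \<in> S z \<Longrightarrow> exp (h z c) = l (m z c - a)"
    by metis
  have S01: "0 \<in> S z" "1 \<in> S z" if "z \<in> Z" for z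
    using that p(2) Z by (auto simp: S_def line_slice_def)
  obtain B where B: "\<And>x. norm (l x) \<le> norm x * B" "B > 0"
    using bounded_linear.pos_bounded[OF l] by blast
  have "continuous (at z1 within Z) (\<lambda>z. h z 1)" if z1: "z1 \<in> Z" for z1
  proof -
    have pc: "path_connected (S z1)"
      using simply_connected_line_slice[OF D] by (simp add: S_def simply_connected_imp_path_connected)
    \<comment> \<open>The slice need not be convex, so the parameters 0 and 1 are joined by a path
      in it. Its compact image keeps a distance \<open>e\<close> from the complement of
      \<open>D\<close>, and \<open>l\<close> is bounded below on it by \<open>\<mu>\<close>.\<close>
    obtain \<gamma> where \<gamma>: "path \<gamma>" "path_image \<gamma> \<subseteq> S z1" "pathstart \<gamma> = 0" "pathfinish \<gamma> = 1"
      using pc S01[OF z1] unfolding path_connected_def by blast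
    define K where "K = path_image \<gamma>"
    have K: "compact K" "connected K" "0 \<in> K" "1 \<in> K" "K \<subseteq> S z1"
      using \<gamma> pathstart_in_path_image[of \<gamma>] pathfinish_in_path_image[of \<gamma>]
      by (auto simp: K_def compact_path_image connected_path_image)
    have cK: "compact (m z1 ` K)"
      using contm K(1) by (rule compact_continuous_image)
    have KD: "m z1 ` K \<subseteq> D"
      using K(5) mD by auto
    obtain e where e: "e > 0" "\<And>x y. x \<in> m z1 ` K \<Longrightarrow> dist x y < e \<Longrightarrow> y \<in> D"
    proof -
      obtain e where "e > 0" "(\<Union>x\<in>m z1 ` K. ball x e) \<subseteq> D"
        using compact_subset_open_imp_ball_epsilon_subset[OF cK _ KD] D
        by (auto simp: C_convex_domain_def)
      then show thesis by (intro that[of e]) (assumption, metis UN_I mem_ball subsetD)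
    qed
    obtain \<mu> where mu: "\<mu> > 0" "\<And>c. c \<in> K \<Longrightarrow> \<mu> \<le> norm (l (m z1 c - a))"
    proof -
      have "continuous_on K (\<lambda>c. norm (l (m z1 c - a)))"
        by (intro continuous_on_norm continuous_on_compose2[OF cl[of UNIV]]) (auto intro!: continuous_intros contm)
      then obtain c0 where "c0 \<in> K" "\<And>c. c \<in> K \<Longrightarrow> norm (l (m z1 c0 - a)) \<le> norm (l (m z1 c - a))"
        using continuous_attains_inf[OF K(1)] K(3) by (metis empty_iff)
      moreover have "l (m z1 c0 - a) \<noteq> 0"
        using nz[OF z1, of c0] K(5) \<open>c0 \<in> K\<close> by (auto simp: S_def m_def)
      ultimately show thesis by (intro that[of "norm (l (m z1 c0 - a))"]) auto
    qed
    have lK: "l (m z1 c - a) \<noteq> 0" if "c \<in> K" for c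
      using mu(1) mu(2)[OF that] by auto
    obtain M where M: "\<And>c. c \<in> K \<Longrightarrow> norm c \<le> M" "M > 0"
      using compact_imp_bounded[OF K(1)] by (auto simp: bounded_pos)
    \<comment> \<open>\<open>N z\<close> bounds how far the points with parameter in
      \<open>K\<close> move when \<open>z1\<close> is replaced by \<open>z\<close>; it tends to 0 as
      \<open>z\<close> tends to \<open>z1\<close>.\<close>
    define N where "N = (\<lambda>z. norm (p z - p z1) + M * (norm (z - z1) + norm (p z - p z1)))"
    have mN: "norm (m z c - m z1 c) \<le> N z" if "c \<in> K" for z c
    proof -
      have "m z c - m z1 c = (p z - p z1) + c *s ((z - z1) - (p z - p z1))"
        by (simp add: m_def vec_eq_iff algebra_simps)
      then have "norm (m z c - m z1 c) \<le> norm (p z - p z1) + norm c * norm ((z - z1) - (p z - p z1))"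
        by (metis norm_triangle_ineq norm_vector_scalar_mult)
      also have "\<dots> \<le> norm (p z - p z1) + M * (norm (z - z1) + norm (p z - p z1))"
        using M(1)[OF that] M(2) norm_triangle_ineq4[of "z - z1" "p z - p z1"]
        by (intro add_left_mono mult_mono) auto
      finally show ?thesis by (simp add: N_def)
    qed
    have pt: "(p \<longlongrightarrow> p z1) (at z1 within Z)"
      using p(1) z1 by (simp add: continuous_on)
    have "(N \<longlongrightarrow> norm (p z1 - p z1) + M * (norm (z1 - z1) + norm (p z1 - p z1))) (at z1 within Z)"
      unfolding N_def by (intro tendsto_intros pt)
    then have N0: "(N \<longlongrightarrow> 0) (at z1 within Z)" by simp
    \<comment> \<open>On a compact connected part of the slice at \<open>z1\<close> the branches at \<open>z\<close> and \<open>z1\<close> differ by the principal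
      logarithm of the quotient \<open>q z\<close>, which is close to \<open>1\<close>.\<close>
    define q where "q = (\<lambda>z c. l (m z c - a) / l (m z1 c - a))"
    have q: "norm (q z c - 1) \<le> N z * B / \<mu>" if "c \<in> K" for z c
    proof -
      have "q z c - 1 = l (m z c - m z1 c) / l (m z1 c - a)"
        using l lK[OF that] by (simp add: q_def field_simps bounded_linear.linear linear_diff)
      then have "norm (q z c - 1) = norm (l (m z c - m z1 c)) / norm (l (m z1 c - a))"
        by (simp add: norm_divide)
      also have "\<dots> \<le> (N z * B) / \<mu>"
      proof (rule frac_le)
        show "norm (l (m z c - m z1 c)) \<le> N z * B"
          using B(1)[of "m z c - m z1 c"] mN[OF that] B(2)
          by (meson less_imp_le mult_right_mono order_trans)
        then show "0 \<le> N z * B" using norm_ge_zero order_trans by blast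
      qed (use mu that in auto)
      finally show ?thesis .
    qed
    have key: "h z 1 = h z1 1 + Ln (q z 1)" if z: "z \<in> Z" "N z < e" "N z * B / \<mu> < 1" for z
    proof -
      have Sz: "c \<in> S z" if "c \<in> K" for c
        using e(2)[of "m z1 c" "m z c"] mN[OF that, of z] that z(2) mD
        by (auto simp: dist_norm norm_minus_commute)
      have q1: "norm (q z c - 1) < 1" if "c \<in> K" for c
        using q[OF that, of z] z(3) by linarith
      have qnn: "q z c \<notin> \<real>\<^sub>\<le>\<^sub>0" if "c \<in> K" for c
      proof -
        have "\<bar>Re (q z c - 1)\<bar> < 1"
          using q1[OF that] abs_Re_le_cmod[of "q z c - 1"] by linarith
        then show ?thesis by (auto simp: complex_nonpos_Reals_iff)
      qed
      have cq: "continuous_on K (q z)"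
        unfolding q_def using lK
        by (intro continuous_on_divide continuous_on_compose2[OF cl[of UNIV]])
           (auto intro!: continuous_intros contm) 
      have "h z 1 - (h z1 1 + Ln (q z 1)) = h z 0 - (h z1 0 + Ln (q z 0))"
      proof (rule exp_eq_imp_diff_constant[OF K(2)])
        show "continuous_on K (h z)"
          using h(1)[OF z(1)] Sz by (meson continuous_on_subset subsetI)
        show "continuous_on K (\<lambda>c. h z1 c + Ln (q z c))"
          using h(1)[OF z1] K(5) qnn cq
          by (intro continuous_intros) (auto intro: continuous_on_subset)
        fix c assume c: "c \<in> K"
        have "l (m z1 c - a) \<noteq> 0" "q z c \<noteq> 0" using lK[OF c] qnn[OF c] by auto
        then show "exp (h z c) = exp (h z1 c + Ln (q z c))"
          using h(3)[OF z(1) Sz[OF c]] h(3)[OF z1] K(5) c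
          by (auto simp: exp_add q_def)
      qed (use K in auto)
      \<comment> \<open>Here the common value \<open>exp L\<close> at the base points enters: both
        branches start at \<open>L\<close> and \<open>Ln 1 = 0\<close>, so the constant difference
        vanishes.\<close>
      moreover have "q z 0 = 1"
      proof -
        have "l (p z - a) = l (p z1 - a)" using L z(1) z1 by metis
        moreover have "l (p z1 - a) \<noteq> 0" using L[OF z1] by (metis exp_not_eq_zero)
        ultimately show ?thesis by (simp add: q_def m0)
      qed
      ultimately show ?thesis using h(2) z(1) z1 by simp
    qed
    have ev: "\<forall>\<^sub>F z in at z1 within Z. h z1 1 + Ln (q z 1) = h z 1"
    proof -
      have "((\<lambda>z. N z * B / \<mu>) \<longlongrightarrow> 0 * B / \<mu>) (at z1 within Z)"
        using mu(1) by (intro tendsto_intros N0) auto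
      then have "\<forall>\<^sub>F z in at z1 within Z. N z * B / \<mu> < 1"
        by (rule order_tendstoD(2)) simp
      moreover have "\<forall>\<^sub>F z in at z1 within Z. N z < e"
        by (rule order_tendstoD(2)[OF N0 e(1)])
      moreover have "\<forall>\<^sub>F z in at z1 within Z. z \<in> Z"
        by (auto simp: eventually_at_filter)
      ultimately show ?thesis by eventually_elim (simp add: key)
    qed
    have "((\<lambda>z. q z 1) \<longlongrightarrow> 1) (at z1 within Z)"
    proof -
      have "((\<lambda>z. N z * B / \<mu>) \<longlongrightarrow> 0) (at z1 within Z)"
        using tendsto_divide[OF tendsto_mult[OF N0 tendsto_const[of B]] tendsto_const[of \<mu>]] mu(1) by simp
      then have "((\<lambda>z. q z 1 - 1) \<longlongrightarrow> 0) (at z1 within Z)"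
        by (rule Lim_null_comparison[rotated]) (use q K(4) in auto)
      then show ?thesis by (rule LIM_zero_cancel)
    qed
    then have "((\<lambda>z. h z1 1 + Ln (q z 1)) \<longlongrightarrow> h z1 1 + Ln 1) (at z1 within Z)"
      by (intro tendsto_intros) auto
    then have "((\<lambda>z. h z 1) \<longlongrightarrow> h z1 1) (at z1 within Z)"
      using ev by (simp add: tendsto_cong)
    then show ?thesis by (simp add: continuous_within)
  qed
  then have "continuous_on Z (\<lambda>z. h z 1)"
    by (simp add: continuous_on_eq_continuous_within)
  moreover have "exp (h z 1) = l (z - a)" if "z \<in> Z" for z
    using h(3)[OF that S01(2)[OF that]] by (simp add: m1)
  ultimately show thesis by (rule that)
qed

subsection \<open>Complex hyperplanes missing a C-convex domain\<close>

text \<open>Along the circle a branch agrees up to a constant with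
  \<open>Ln \<epsilon> + \<i> * \<theta>\<close>, which gains \<open>2 * pi * \<i>\<close> in one
  turn.\<close>

lemma no_continuous_log_on_circle:
  assumes cont: "continuous_on (sphere 0 1) \<Lambda>"
    and exp: "\<And>\<zeta>::complex. norm \<zeta> = 1 \<Longrightarrow> exp (\<Lambda> \<zeta>) = of_real \<epsilon> * \<zeta>"
    and eps: "\<epsilon> > 0"
  shows False
proof -
  have c: "continuous_on {0..2*pi} (\<lambda>\<theta>::real. \<Lambda> (cis \<theta>))"
    by (rule continuous_on_compose2[OF cont]) (auto intro!: continuous_intros)
  have "\<Lambda> (cis (2*pi)) - (Ln \<epsilon> + \<i> * of_real (2*pi)) = \<Lambda> (cis 0) - (Ln \<epsilon> + \<i> * of_real 0)"
    by (rule exp_eq_imp_diff_constant[OF _ c])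
       (use eps in \<open>auto intro!: continuous_intros simp: exp exp_add cis_conv_exp\<close>)
  then show False by simp
qed

text \<open>A basis of the span stays independent when \<open>u\<close> is adjoined, so a complex
  linear map can be prescribed on it and at \<open>u\<close> separately.\<close>

lemma complex_linear_separating:
  fixes W :: "(complex^'n) set"
  assumes "u \<notin> vec.span W"
  obtains l :: "complex^'n \<Rightarrow> complex"
    where "bounded_linear l" "\<And>c v. l (c *s v) = c * l v" "\<And>w. w \<in> vec.span W \<Longrightarrow> l w = 0" "l u = 1"
proof -
  obtain B where B: "B \<subseteq> W" "vec.independent B" "W \<subseteq> vec.span B"
    using vec.maximal_independent_subset by blast
  have sp: "vec.span B = vec.span W"
    using B by (metis vec.span_mono vec.span_span subset_antisym)
  then have "vec.independent (insert u B)"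
    using assms B(2) by (auto simp: vec.independent_insert)
  then obtain F where F: "Vector_Spaces.linear (*s) (*s) F" 
    "\<forall>x\<in>insert u B. F x = (if x = u then (1::complex^'n) else 0)"
    using vec.linear_independent_extend[where f = "\<lambda>x. if x = u then 1 else 0"] by blast
  interpret F: Vector_Spaces.linear "(*s)" "(*s)" F by fact
  have Fw: "F w = 0" if "w \<in> vec.span W" for w
  proof -
    have "w \<in> vec.span B" using that sp by simp
    then show ?thesis
      by (rule F.eq_0_on_span[rotated]) (use F(2) assms sp vec.span_base in fastforce)
  qed
  \<comment> \<open>Any coordinate works, since \<open>F u\<close> is the vector of ones.\<close>
  have "linear (\<lambda>x. F x $ undefined)"
  proof (rule linearI)
    fix r :: real and x :: "complex^'n"
    have "r *\<^sub>R x = of_real r *s x" by (simp add: vec_eq_iff scaleR_conv_of_real[where 'a = complex])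
    then show "F (r *\<^sub>R x) $ undefined = r *\<^sub>R (F x $ undefined)"
      by (simp add: F.scale scaleR_conv_of_real[where 'a = complex])
  qed (simp add: F.add)
  then have "bounded_linear (\<lambda>x. F x $ undefined)"
    by (rule linear_conv_bounded_linear[THEN iffD1])
  then show thesis
    by (rule that) (use F(2) Fw in \<open>auto simp: F.scale\<close>)
qed

text \<open>The \<open>A i\<close> are defined on discs of twice the radius of the bumps, since they may be unbounded
  near the boundary of their domain.\<close>

lemma continuous_on_bump_sum:
  fixes A :: "'i \<Rightarrow> 'a::topological_space \<Rightarrow> complex" and \<tau> :: "'a \<Rightarrow> complex"
  assumes "finite I" and \<tau>: "continuous_on Z \<tau>"
    and r: "\<And>i. i \<in> I \<Longrightarrow> r i > 0"
    and A: "\<And>i. i \<in> I \<Longrightarrow> continuous_on {z\<in>Z. dist (c i) (\<tau> z) < 2 * r i} (A i)"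
  shows "continuous_on Z (\<lambda>z. \<Sum>i\<in>I. of_real (max 0 (r i - dist (c i) (\<tau> z))) * A i z)"
proof (rule continuous_on_sum)
  fix i assume i: "i \<in> I"
  let ?f = "\<lambda>z. of_real (max 0 (r i - dist (c i) (\<tau> z))) * A i z"
  have ct: "continuous_on Z (\<lambda>z. dist (c i) (\<tau> z))"
    by (intro continuous_intros \<tau>)
  have "continuous_on Z (\<lambda>z. if dist (c i) (\<tau> z) \<le> r i then ?f z else 0)"
  proof (rule continuous_on_cases_le)
    have "{z\<in>Z. dist (c i) (\<tau> z) \<le> r i} \<subseteq> {z\<in>Z. dist (c i) (\<tau> z) < 2 * r i}"
      using r[OF i] by auto
    then show "continuous_on {z\<in>Z. dist (c i) (\<tau> z) \<le> r i} ?f"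
      using A[OF i] \<tau> by (intro continuous_intros) (auto intro: continuous_on_subset)
  qed (use ct in auto)
  then show "continuous_on Z ?f"
    by (rule continuous_on_eq) auto
qed

text \<open>\<open>meet\<close> expresses the maximality of \<open>W\<close>, while \<open>u\<close>
  and \<open>v\<close> witness codimension at least two. The whole argument takes place in
  \<open>a\<close> plus the span of \<open>u\<close>, \<open>v\<close> and \<open>W\<close>, with
  coordinates \<open>x = \<xi>\<close> and \<open>y = \<eta>\<close>.\<close>

lemma C_convex_missing_subspace_not_maximal:
  fixes D :: "(complex^'n) set"
  assumes D: "C_convex_domain D"
    and miss: "\<And>z. z \<in> D \<Longrightarrow> z - a \<notin> vec.span W"
    and meet: "\<And>w. w \<notin> vec.span W \<Longrightarrow> \<exists>z\<in>D. z - a \<in> vec.span (insert w W)"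
    and u: "u \<notin> vec.span W" and v: "v \<notin> vec.span (insert u W)"
  shows False
proof -
  have openD: "open D" using D by (simp add: C_convex_domain_def)

  \<comment> \<open>Coordinates modulo \<open>W\<close> and the fibres of given slope\<close>
  have vW: "v \<notin> vec.span W"
    using v by (meson subset_insertI subsetD vec.span_mono)
  have u': "u \<notin> vec.span (insert v W)"
    using u v vec.in_span_insert by blast
  obtain \<xi> where \<xi>: "bounded_linear \<xi>" "\<And>c v. \<xi> (c *s v) = c * \<xi> v"
      "\<And>w. w \<in> vec.span (insert v W) \<Longrightarrow> \<xi> w = 0" "\<xi> u = 1"
    using complex_linear_separating[OF u'] by blast
  obtain \<eta> where \<eta>: "bounded_linear \<eta>" "\<And>c v. \<eta> (c *s v) = c * \<eta> v"
      "\<And>w. w \<in> vec.span (insert u W) \<Longrightarrow> \<eta> w = 0" "\<eta> v = 1"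
    using complex_linear_separating[OF v] by blast
  interpret \<xi>: bounded_linear \<xi> by (rule \<xi>(1))
  interpret \<eta>: bounded_linear \<eta> by (rule \<eta>(1))
  have W0: "\<xi> w = 0" "\<eta> w = 0" if "w \<in> vec.span W" for w
    using that \<xi>(3) \<eta>(3) by (meson subset_insertI subsetD vec.span_mono)+
  have \<xi>v: "\<xi> v = 0" and \<eta>u: "\<eta> u = 0"
    using \<xi>(3) \<eta>(3) by (auto intro: vec.span_base)
  \<comment> \<open>\<open>F t\<close> is the part of \<open>D\<close> over the line
    \<open>y = t x\<close>. There \<open>x\<close> has no zero because \<open>a + W\<close> misses
    \<open>D\<close>, so \<open>\<tau>\<close> recovers the slope. The fibre over
    \<open>x = 0\<close>, of infinite slope, is left out of \<open>E\<close>.\<close>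
  define F where "F = (\<lambda>t. {z\<in>D. z - a \<in> vec.span (insert (u + t *s v) W)})"
  define \<tau> where "\<tau> = (\<lambda>z. \<eta> (z - a) / \<xi> (z - a))"
  define E where "E = {z. \<exists>t. z \<in> F t}"
  have F_I: "z \<in> F t" if "z \<in> D" "z - a - x *s (u + t *s v) \<in> vec.span W" for z t x
    using that by (auto simp: F_def vec.span_breakdown_eq)
  have F_D: "\<xi> (z - a) \<noteq> 0 \<and> \<tau> z = t \<and> z \<in> D \<and> z \<in> E 
      \<and> z - a - \<xi> (z - a) *s (u + t *s v) \<in> vec.span W" if z: "z \<in> F t" for z t
  proof -
    obtain x where x: "z - a - x *s (u + t *s v) \<in> vec.span W"
      using z by (auto simp: F_def vec.span_breakdown_eq)
    have "\<xi> (z - a) = x"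
      using W0(1)[OF x] by (simp add: \<xi>.diff \<xi>.add \<xi>(2) \<xi>(4) \<xi>v)
    moreover have "\<eta> (z - a) = x * t"
      using W0(2)[OF x] by (simp add: \<eta>.diff \<eta>.add \<eta>(2) \<eta>(4) \<eta>u)
    moreover have "x \<noteq> 0"
      using x miss[of z] z by (auto simp: F_def)
    ultimately show ?thesis
      using z x by (auto simp: \<tau>_def E_def F_def)
  qed
  have E_F: "z \<in> F (\<tau> z)" if "z \<in> E" for z
    using that F_D by (auto simp: E_def)
  have E_nz: "\<xi> (z - a) \<noteq> 0" if "z \<in> E" for z
    using that F_D by (auto simp: E_def)
  have E_D: "E \<subseteq> D" using F_D by (auto simp: E_def)
  have F_line: "p + c *s (z - p) \<in> F t"
    if "p \<in> F t" "z \<in> F t" "c \<in> line_slice D p (z - p)" for p z t c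
  proof -
    have "p + c *s (z - p) - a = (p - a) + c *s ((z - a) - (p - a))"
      by simp
    also have "\<dots> \<in> vec.span (insert (u + t *s v) W)"
      using that(1,2) unfolding F_def
      by (blast intro: vec.span_add vec.span_scale vec.span_diff[of "z - a" _ "p - a"])
    finally show ?thesis
      using that(3) by (simp add: F_def line_slice_def)
  qed
  have cont\<xi>: "continuous_on S (\<lambda>z. \<xi> (z - a))" and cont\<eta>: "continuous_on S (\<lambda>z. \<eta> (z - a))" for S
    by (intro \<xi>.continuous_on \<eta>.continuous_on continuous_intros)+
  have \<tau>: "continuous_on E \<tau>"
    unfolding \<tau>_def by (intro continuous_intros cont\<xi> cont\<eta>) (use E_nz in auto)

  \<comment> \<open>Branches of \<open>log x\<close> over small discs of slopes, together with
    continuous sections of the fibres\<close>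
  define local_log where "local_log = (\<lambda>t0 r A s. r > 0 \<and> continuous_on {z\<in>E. dist t0 (\<tau> z) < 2 * r} A \<and>
      (\<forall>z\<in>E. dist t0 (\<tau> z) < 2 * r \<longrightarrow> exp (A z) = \<xi> (z - a)) \<and>
      continuous_on (ball t0 (2 * r)) s \<and> (\<forall>t. dist t0 t < 2 * r \<longrightarrow> s t \<in> F t))"
  have "\<exists>r A s. local_log t0 r A s" for t0
  proof -
    have "u + t0 *s v \<notin> vec.span W"
      using W0(1)[of "u + t0 *s v"] by (auto simp: \<xi>.add \<xi>(2) \<xi>(4) \<xi>v)
    then obtain p0 where p0: "p0 \<in> F t0"
      using meet by (auto simp: F_def)
    define x0 where "x0 = \<xi> (p0 - a)"
    \<comment> \<open>Moving \<open>p0\<close> along \<open>v\<close> changes only \<open>y\<close>,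
      and the shift by \<open>(t - t0) * x0\<close> turns the slope \<open>t0\<close> into
      \<open>t\<close>. Since \<open>x\<close> keeps the value \<open>x0\<close>, these points are
      admissible base points with \<open>L = Ln x0\<close>.\<close>
    define s where "s = (\<lambda>t. p0 + ((t - t0) * x0) *s v)"
    have conts: "continuous_on X s" for X
      unfolding s_def by (intro continuous_intros)
    have "open (s -` D)"
      using open_vimage[OF openD conts[of UNIV]] .
    moreover have "t0 \<in> s -` D" using F_D[OF p0] by (simp add: s_def)
    ultimately obtain e where e: "e > 0" "ball t0 e \<subseteq> s -` D"
      using open_contains_ball by blast
    have sF: "s t \<in> F t" if "t \<in> ball t0 e" for t
    proof (rule F_I[where x = x0])
      show "s t \<in> D" using e that by auto
      have "s t - a - x0 *s (u + t *s v) = p0 - a - x0 *s (u + t0 *s v)"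
        by (simp add: s_def vec_eq_iff algebra_simps)
      then show "s t - a - x0 *s (u + t *s v) \<in> vec.span W"
        using F_D[OF p0] unfolding x0_def by metis
    qed
    define Z where "Z = {z\<in>E. dist t0 (\<tau> z) < 2 * (e / 2)}"
    have ZE: "Z \<subseteq> E" by (auto simp: Z_def)
    have sZ: "s (\<tau> z) \<in> F (\<tau> z)" if "z \<in> Z" for z
      using that by (intro sF) (auto simp: Z_def)
    have "continuous_on Z \<tau>"
      using \<tau> ZE by (rule continuous_on_subset)
    then have cp: "continuous_on Z (\<lambda>z. s (\<tau> z))"
      by (rule continuous_on_compose2[OF conts[of UNIV]]) auto
    obtain A where "continuous_on Z A" "\<And>z. z \<in> Z \<Longrightarrow> exp (A z) = \<xi> (z - a)"
    proof (rule continuous_log_along_lines[OF D cp _ _ \<xi>(1), where a = a and L = "Ln x0"])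
      show "s (\<tau> z) \<in> D" if "z \<in> Z" for z
        using F_D[OF sZ[OF that]] by simp
      show "Z \<subseteq> D" using ZE E_D by auto
      show "\<xi> (s (\<tau> z) + c *s (z - s (\<tau> z)) - a) \<noteq> 0" 
        if "z \<in> Z" "c \<in> line_slice D (s (\<tau> z)) (z - s (\<tau> z))" for z c
        using F_D[OF F_line[OF sZ[OF that(1)] E_F that(2)]] ZE that by auto
      show "exp (Ln x0) = \<xi> (s (\<tau> z) - a)" if "z \<in> Z" for z
        using F_D[OF p0] by (simp add: s_def x0_def \<xi>.add \<xi>.diff \<xi>(2) \<xi>v)
      fix A assume "continuous_on Z A" "\<And>z. z \<in> Z \<Longrightarrow> exp (A z) = \<xi> (z - a)"
      then show thesis by (rule that)
    qed
    then show ?thesis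
      using e(1) conts sF by (intro exI[of _ "e/2"] exI[of _ A] exI[of _ s]) (auto simp: Z_def local_log_def)
  qed
  then obtain r A s where "\<And>i. local_log i (r i) (A i) (s i)"
    by metis
  then have r: "\<And>i. r i > 0"
    and A: "\<And>i. continuous_on {z\<in>E. dist i (\<tau> z) < 2 * r i} (A i)"
      "\<And>i z. z \<in> E \<Longrightarrow> dist i (\<tau> z) < 2 * r i \<Longrightarrow> exp (A i z) = \<xi> (z - a)"
    and s: "\<And>i. continuous_on (ball i (2 * r i)) (s i)"
      "\<And>i t. dist i t < 2 * r i \<Longrightarrow> s i t \<in> F t"
    by (auto simp: local_log_def)

  \<comment> \<open>A point of \<open>D\<close> with \<open>x = 0\<close> and a circle around
    it\<close>
  obtain q where q: "q \<in> D" "q - a \<in> vec.span (insert v W)"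
    using meet[OF vW] by blast
  then obtain y0 where y0: "q - a - y0 *s v \<in> vec.span W"
    by (auto simp: vec.span_breakdown_eq)
  have "y0 \<noteq> 0" using y0 miss[OF q(1)] by auto
  obtain e where e: "e > 0" "ball q e \<subseteq> D"
    using openD q(1) open_contains_ball by blast
  \<comment> \<open>The circle \<open>q + \<epsilon> \<zeta> u\<close> must stay in
    \<open>ball q e\<close>. On it \<open>x = \<epsilon> \<zeta>\<close> and \<open>y = y0\<close>,
    so every slope there has modulus exactly \<open>R\<close>, as defined below.\<close>
  define \<epsilon> where "\<epsilon> = e / (2 * (norm u + 1))"
  have \<epsilon>: "\<epsilon> > 0" using e(1) by (simp add: \<epsilon>_def add_nonneg_pos)
  have \<epsilon>u: "\<epsilon> * norm u < e"
  proof -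
    have n: "norm u + 1 > 0" by (simp add: add_nonneg_pos)
    have "\<epsilon> * norm u \<le> \<epsilon> * (norm u + 1)" using \<epsilon> by simp
    also have "\<dots> = e / 2"
    proof -
      have "e / (2 * m) * m = e / 2" if "m > 0" for m :: real using that by simp
      from this[OF n] show ?thesis by (simp only: \<epsilon>_def)
    qed
    finally show ?thesis using e(1) by simp
  qed
  define R where "R = norm y0 / \<epsilon>"

  \<comment> \<open>Averaging the local branches over the closed disc of slopes\<close>
  obtain I where I: "finite I" "cball 0 R \<subseteq> (\<Union>i\<in>I. ball i (r i))"
  proof -
    have "cball 0 R \<subseteq> (\<Union>i\<in>cball 0 R. ball i (r i))" using r by force
    then show thesis
      using compactE_image[OF compact_cball, of "cball 0 R" "\<lambda>i. ball i (r i)"] that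
      by (metis open_ball)
  qed
  \<comment> \<open>Any two branches differ by a constant on each fibre \<open>F t\<close>. Hence their weighted average \<open>M\<close> differs
    from each of them by a function of \<open>t\<close> alone, which has a logarithm on the disc.\<close>
  define \<phi> where "\<phi> = (\<lambda>i t. max 0 (r i - dist i t))"
  define \<Phi> where "\<Phi> = (\<lambda>t. \<Sum>i\<in>I. \<phi> i t)"
  define M where "M = (\<lambda>z. (\<Sum>i\<in>I. of_real (\<phi> i (\<tau> z)) * A i z) / of_real (\<Phi> (\<tau> z)))"
  define ER where "ER = {z\<in>E. \<tau> z \<in> cball 0 R}"
  have \<Phi>: "\<Phi> t > 0" if "t \<in> cball 0 R" for t
  proof -
    obtain i where "i \<in> I" "dist i t < r i" using I(2) \<open>t \<in> cball 0 R\<close> by auto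
    then show ?thesis
      unfolding \<Phi>_def by (intro sum_pos2[OF I(1)]) (auto simp: \<phi>_def)
  qed
  have contM: "continuous_on ER M"
  proof -
    have t: "continuous_on ER \<tau>"
      using \<tau> by (rule continuous_on_subset) (auto simp: ER_def)
    have "continuous_on ER (\<lambda>z. \<Sum>i\<in>I. of_real (\<phi> i (\<tau> z)) * A i z)"
      unfolding \<phi>_def
      by (rule continuous_on_bump_sum[OF I(1) t r])
         (rule continuous_on_subset[OF A(1)], auto simp: ER_def)
    moreover have "continuous_on ER (\<lambda>z. of_real (\<Phi> (\<tau> z)) :: complex)"
      unfolding \<Phi>_def \<phi>_def by (intro continuous_intros t)
    ultimately show ?thesis
      unfolding M_def using \<Phi> by (intro continuous_on_divide) (auto simp: ER_def less_imp_neq[THEN not_sym])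
  qed
  have M_F: "\<xi> (z - a) * exp (- M z) = \<xi> (z' - a) * exp (- M z')"
    if z: "z \<in> F t" and z': "z' \<in> F t" and t: "t \<in> cball 0 R" for z z' t
  proof -
    obtain j where j: "j \<in> I" "dist j t < r j" using I(2) t by auto
    \<comment> \<open>Branches are compared on the slice of \<open>D\<close> by the line through
      \<open>z'\<close> and \<open>z\<close>, which is connected and stays in the fibre
      \<open>F t\<close>.\<close>
    define C where "C = (\<lambda>c. z' + c *s (z - z')) ` line_slice D z' (z - z')"
    have "connected C"
      unfolding C_def
      by (intro connected_continuous_image continuous_on_line simply_connected_imp_connected
          simply_connected_line_slice D)
    moreover have C_F: "C \<subseteq> F t"
      using F_line[OF z' z] by (auto simp: C_def)
    moreover have "z' \<in> C"
      unfolding C_def by (rule image_eqI[of _ _ 0]) (use F_D[OF z'] in \<open>auto simp: line_slice_def\<close>)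
    moreover have "z \<in> C"
      unfolding C_def by (rule image_eqI[of _ _ 1]) (use F_D[OF z] in \<open>auto simp: line_slice_def\<close>)
    moreover have C_A: "continuous_on C (A i)" "\<And>x. x \<in> C \<Longrightarrow> exp (A i x) = \<xi> (x - a)"
      if "dist i t < 2 * r i" for i
      using that C_F F_D by (auto intro!: continuous_on_subset[OF A(1)[of i]] A(2))
    moreover have rj: "dist j t < 2 * r j" using j r[of j] by linarith
    ultimately have const: "A i z - A j z = A i z' - A j z'" if "dist i t < 2 * r i" for i
      using that by (intro exp_eq_imp_diff_constant[of C "A i" "A j"]) auto
    define \<delta> where "\<delta> = A j z - A j z'"
    have "(\<Sum>i\<in>I. of_real (\<phi> i t) * A i z) - (\<Sum>i\<in>I. of_real (\<phi> i t) * A i z')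
        = (\<Sum>i\<in>I. of_real (\<phi> i t) * \<delta>)"
      unfolding sum_subtractf[symmetric]
    proof (rule sum.cong[OF refl])
      fix i
      show "of_real (\<phi> i t) * A i z - of_real (\<phi> i t) * A i z' = of_real (\<phi> i t) * \<delta>"
      proof (cases "dist i t < 2 * r i")
        case True
        then have "A i z - A i z' = \<delta>" using const[of i] by (simp add: \<delta>_def algebra_simps)
        then show ?thesis by (metis right_diff_distrib)
      next
        case False
        then show ?thesis using r[of i] by (simp add: \<phi>_def)
      qed
    qed
    also have "\<dots> = of_real (\<Phi> t) * \<delta>"
      by (simp add: \<Phi>_def sum_distrib_right)
    finally have "M z - M z' = \<delta>"
      using \<Phi>[OF t] F_D[OF z] F_D[OF z'] by (simp add: M_def diff_divide_distrib[symmetric])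
    moreover have "exp (A j z) = \<xi> (z - a)" "exp (A j z') = \<xi> (z' - a)"
      using F_D[OF z] F_D[OF z'] rj by (auto intro!: A(2))
    ultimately have "\<xi> (z - a) = \<xi> (z' - a) * exp (M z - M z')"
      using F_D[OF z'] by (simp add: \<delta>_def exp_diff)
    then show ?thesis
      by (simp add: exp_diff exp_minus field_simps)
  qed

  \<comment> \<open>The correction depending on the slope alone\<close>
  define \<sigma> where "\<sigma> = (\<lambda>t. SOME z. z \<in> F t)"
  have \<sigma>: "\<sigma> t \<in> F t" for t
    unfolding \<sigma>_def using s(2)[of t t] r[of t] by (intro someI) auto
  define g where "g = (\<lambda>t. \<xi> (\<sigma> t - a) * exp (- M (\<sigma> t)))"
  have g: "g t = \<xi> (z - a) * exp (- M z)" if "z \<in> F t" "t \<in> cball 0 R" for z t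
    using M_F[OF that(1) \<sigma> that(2)] by (simp add: g_def)
  \<comment> \<open>The choice \<open>\<sigma>\<close> may be discontinuous, but by
    \<open>M_F\<close> any point of the fibre gives the same \<open>g t\<close>. Near
    \<open>t0\<close> the continuous section \<open>s t0\<close> can therefore be used.\<close>
  have "continuous_on (cball 0 R) g"
    unfolding continuous_on_eq_continuous_within
  proof
    fix t0 :: complex assume t0: "t0 \<in> cball 0 R"
    define U where "U = ball t0 (2 * r t0)"
    have sU: "continuous_on (cball 0 R \<inter> U) (s t0)"
      using s(1)[of t0] by (rule continuous_on_subset) (auto simp: U_def)
    have sER: "s t0 t \<in> ER" if "t \<in> cball 0 R \<inter> U" for t
      using F_D[OF s(2)[of t0 t]] that by (auto simp: U_def ER_def)
    have "continuous_on (cball 0 R \<inter> U) (\<lambda>t. \<xi> (s t0 t - a) * exp (- M (s t0 t)))"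
      by (intro continuous_intros \<xi>.continuous_on sU continuous_on_compose2[OF contM sU])
         (use sER in auto)
    then have "continuous_on (cball 0 R \<inter> U) g"
      by (rule continuous_on_eq) (auto simp: U_def intro!: g[symmetric] s(2))
    moreover have tU: "t0 \<in> U" using r by (simp add: U_def)
    ultimately have "continuous (at t0 within cball 0 R \<inter> U) g"
      using t0 by (simp add: continuous_on_eq_continuous_within)
    moreover have "at t0 within cball 0 R = at t0 within cball 0 R \<inter> U"
      by (rule at_within_nhd[OF tU]) (auto simp: U_def)
    ultimately show "continuous (at t0 within cball 0 R) g" by simp
  qed
  moreover have "g t \<noteq> 0" for t
    using F_D[OF \<sigma>[of t]] by (simp add: g_def)
  ultimately obtain G where G: "continuous_on (cball 0 R) G" "\<And>t. t \<in> cball 0 R \<Longrightarrow> g t = exp (G t)"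
    using continuous_logarithm_on_cball by blast

  \<comment> \<open>The contradiction by winding\<close>
  define z where "z = (\<lambda>\<zeta>. q + (of_real \<epsilon> * \<zeta>) *s u)"
  have z: "z \<zeta> \<in> F (y0 / (of_real \<epsilon> * \<zeta>)) \<and> \<xi> (z \<zeta> - a) = of_real \<epsilon> * \<zeta>" if "norm \<zeta> = 1" for \<zeta>
  proof
    have nz: "of_real \<epsilon> * \<zeta> \<noteq> 0" using that \<epsilon> by auto
    show "z \<zeta> \<in> F (y0 / (of_real \<epsilon> * \<zeta>))"
    proof (rule F_I[where x = "of_real \<epsilon> * \<zeta>"])
      have "dist q (z \<zeta>) = \<epsilon> * norm u"
        using that \<epsilon> by (simp add: z_def dist_norm norm_vector_scalar_mult norm_mult)
      then show "z \<zeta> \<in> D" using e \<epsilon>u by auto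
      have "z \<zeta> - a - (of_real \<epsilon> * \<zeta>) *s (u + (y0 / (of_real \<epsilon> * \<zeta>)) *s v) = q - a - y0 *s v"
        using nz by (simp add: z_def vec_eq_iff field_simps)
      then show "z \<zeta> - a - (of_real \<epsilon> * \<zeta>) *s (u + (y0 / (of_real \<epsilon> * \<zeta>)) *s v) \<in> vec.span W"
        using y0 by metis
    qed
    have "\<xi> (q - a) = 0" using q(2) \<xi>(3) by simp
    then show "\<xi> (z \<zeta> - a) = of_real \<epsilon> * \<zeta>"
      by (simp add: z_def \<xi>.add \<xi>.diff \<xi>(2) \<xi>(4))
  qed
  have zER: "z \<zeta> \<in> ER" if "norm \<zeta> = 1" for \<zeta>
    using F_D[OF conjunct1[OF z[OF that]]] that \<epsilon>
    by (auto simp: ER_def R_def norm_divide norm_mult)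
  have cz: "continuous_on (sphere 0 1) z"
    unfolding z_def by (intro continuous_intros)
  show False
  proof (rule no_continuous_log_on_circle[OF _ _ \<epsilon>])
    have "continuous_on (sphere 0 1) (\<lambda>\<zeta>. \<tau> (z \<zeta>))"
      by (rule continuous_on_compose2[OF \<tau> cz]) (use zER in \<open>auto simp: ER_def\<close>)
    then show "continuous_on (sphere 0 1) (\<lambda>\<zeta>. M (z \<zeta>) + G (\<tau> (z \<zeta>)))"
      by (intro continuous_intros continuous_on_compose2[OF contM cz] continuous_on_compose2[OF G(1)])
         (use zER in \<open>auto simp: ER_def\<close>)
    show "exp (M (z \<zeta>) + G (\<tau> (z \<zeta>))) = of_real \<epsilon> * \<zeta>" if "norm \<zeta> = 1" for \<zeta>
    proof -
      have R: "\<tau> (z \<zeta>) \<in> cball 0 R" and E: "z \<zeta> \<in> E" using zER[OF that] by (auto simp: ER_def)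
      have "exp (M (z \<zeta>) + G (\<tau> (z \<zeta>))) = exp (M (z \<zeta>)) * g (\<tau> (z \<zeta>))"
        using G(2)[OF R] by (simp add: exp_add)
      also have "\<dots> = \<xi> (z \<zeta> - a)"
        using g[OF E_F[OF E] R] by (simp add: exp_minus)
      finally show ?thesis using z[OF that] by simp
    qed
  qed
qed

text \<open>Dimension is bounded, so a maximal \<open>W\<close> exists. By the preceding lemma,
  \<open>W\<close> and one vector \<open>u\<close> from \<open>a\<close> to a point of
  \<open>D\<close> span everything; \<open>l\<close> reads off the coefficient of \<open>u\<close>,
  which is nonzero at points of \<open>D\<close>.\<close>

theorem C_convex_supporting_hyperplane:
  fixes D :: "(complex^'n) set"
  assumes D: "C_convex_domain D" and a: "a \<notin> D"
  obtains l :: "complex^'n \<Rightarrow> complex"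
  where "bounded_linear l" "\<And>c v. l (c *s v) = c * l v" "\<And>z. z \<in> D \<Longrightarrow> l (z - a) \<noteq> 0"
proof -
  define P where "P = (\<lambda>W :: (complex^'n) set. \<forall>z\<in>D. z - a \<notin> vec.span W)"
  have "P {}" using a by (auto simp: P_def)
  moreover have "\<forall>W. P W \<longrightarrow> vec.dim W < CARD('n) + 1"
    using vec.dim_subset_UNIV[where 'b = 'n and 'a = complex]
    by (auto simp: le_imp_less_Suc vec.dimension_def card_cart_basis)
  ultimately obtain W where W: "P W" and max: "\<And>W'. P W' \<Longrightarrow> vec.dim W' \<le> vec.dim W"
    using ex_has_greatest_nat[of P "{}" vec.dim "CARD('n) + 1"] by auto
  have meet: "\<exists>z\<in>D. z - a \<in> vec.span (insert w W)" if "w \<notin> vec.span W" for w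
    using max[of "insert w W"] that by (auto simp: P_def vec.dim_insert)
  have miss: "z - a \<notin> vec.span W" if "z \<in> D" for z
    using W that by (auto simp: P_def)
  obtain z0 where z0: "z0 \<in> D" using D by (auto simp: C_convex_domain_def)
  define u where "u = z0 - a"
  have u: "u \<notin> vec.span W" using miss[OF z0] by (simp add: u_def)
  have all: "v \<in> vec.span (insert u W)" for v
    using C_convex_missing_subspace_not_maximal[OF D miss meet u] by blast
  obtain l where l: "bounded_linear l" "\<And>c v. l (c *s v) = c * l v"
      "\<And>w. w \<in> vec.span W \<Longrightarrow> l w = 0" "l u = 1"
    using complex_linear_separating[OF u] by blast
  interpret l: bounded_linear l by (rule l(1))
  show thesis
  proof (rule that[OF l(1,2)])
    fix z assume z: "z \<in> D"
    obtain c where c: "z - a - c *s u \<in> vec.span W"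
      using all[of "z - a"] by (auto simp: vec.span_breakdown_eq)
    have "l (z - a) = c"
      using l(3)[OF c] by (simp add: l.diff l(2) l(4))
    moreover have "c \<noteq> 0"
      using c miss[OF z] by auto
    ultimately show "l (z - a) \<noteq> 0" by simp
  qed
qed

subsection \<open>Estimates of the invariant metrics by inscribed discs\<close>

text \<open>Near \<open>q\<close> the quotient \<open>f\<close> stays in the disc of radius 1 about
  1, so \<open>A\<close> is \<open>A q\<close> plus the principal logarithm of \<open>f\<close>.
  Continuity of \<open>A\<close> thus already gives its derivative.\<close>

lemma continuous_log_has_derivative:
  fixes l :: "'a::real_normed_vector \<Rightarrow> complex"
  assumes "open D" "continuous_on D A" and l: "bounded_linear l"
    and exp: "\<And>z. z \<in> D \<Longrightarrow> exp (A z) = l (z - a)" and q: "q \<in> D"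
  shows "(A has_derivative (\<lambda>v. l v / l (q - a))) (at q)"
proof -
  interpret l: bounded_linear l by (rule l)
  define f where "f = (\<lambda>z. l (z - a) / l (q - a))"
  have nz: "l (q - a) \<noteq> 0" using exp[OF q] by (metis exp_not_eq_zero)
  have contf: "continuous_on S f" for S
    unfolding f_def using nz by (intro continuous_intros l.continuous_on) auto
  have fq: "f q = 1" using nz by (simp add: f_def)
  have "open (D \<inter> f -` ball 1 1)"
    using open_Int[OF \<open>open D\<close> open_vimage[OF open_ball contf[of UNIV]]] .
  then obtain \<delta> where \<delta>: "\<delta> > 0" "ball q \<delta> \<subseteq> D \<inter> f -` ball 1 1"
    using q fq unfolding open_contains_ball by force
  have nonneg: "f x \<notin> \<real>\<^sub>\<le>\<^sub>0" if "x \<in> ball q \<delta>" for x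
  proof -
    have "norm (1 - f x) < 1" using \<delta>(2) that by (auto simp: dist_norm)
    then have "\<bar>Re (1 - f x)\<bar> < 1" using abs_Re_le_cmod[of "1 - f x"] by linarith
    then show ?thesis by (auto simp: complex_nonpos_Reals_iff)
  qed
  have A: "A q + Ln (f x) = A x" if x: "x \<in> ball q \<delta>" for x
  proof -
    have "A x - (Ln (f x) + A q) = A q - (Ln (f q) + A q)"
    proof (rule exp_eq_imp_diff_constant[of "ball q \<delta>" A "\<lambda>x. Ln (f x) + A q"])
      show "continuous_on (ball q \<delta>) (\<lambda>x. Ln (f x) + A q)"
        using nonneg by (intro continuous_intros contf) auto
      show "continuous_on (ball q \<delta>) A"
        using \<delta>(2) by (intro continuous_on_subset[OF assms(2)]) auto
      show "exp (A y) = exp (Ln (f y) + A q)" if "y \<in> ball q \<delta>" for y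
      proof -
        have "f y \<noteq> 0" using nonneg[OF that] by auto
        then have "exp (Ln (f y) + A q) = f y * l (q - a)" by (simp add: exp_add exp[OF q])
        also have "\<dots> = exp (A y)" using exp[of y] \<delta>(2) that nz by (auto simp: f_def)
        finally show ?thesis by simp
      qed
      show "x \<in> ball q \<delta>" by fact
      show "q \<in> ball q \<delta>" using \<delta>(1) by simp
    qed (auto simp: fq)
    then show ?thesis by (simp add: fq)
  qed
  have "(f has_derivative (\<lambda>v. l v / l (q - a))) (at q)"
    unfolding f_def
    by (rule bounded_linear.has_derivative[OF bounded_linear_divide l.has_derivative])
       (auto intro!: derivative_eq_intros)
  moreover have "(Ln has_derivative (*) 1) (at (f q))"
    using has_field_derivative_Ln[of 1] by (simp add: fq has_field_derivative_def)
  ultimately have "((\<lambda>x. Ln (f x)) has_derivative (\<lambda>v. 1 * (l v / l (q - a)))) (at q)"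
    by (rule has_derivative_compose)
  then have "((\<lambda>x. A q + Ln (f x)) has_derivative (\<lambda>v. l v / l (q - a))) (at q)"
    by (auto intro!: derivative_eq_intros)
  then show ?thesis
    by (rule has_derivative_transform_within_open[OF _ open_ball[of q \<delta>]]) (use \<delta>(1) A in auto)
qed

text \<open>With \<open>\<mu>0\<close> the nearest exit parameter, the square root \<open>h\<close>
  of \<open>l\<close> is \<open>w * csqrt (1 - t / \<mu>0)\<close> on the inscribed disc and covers
  a disc about \<open>w\<close>. Hence \<open>h\<close> omits the opposite disc about
  \<open>- w\<close>, and inverting in that disc gives a bounded competitor.\<close>

lemma C_convex_caratheodory_lower_bound:
  fixes D :: "(complex^'n) set"
  assumes D: "C_convex_domain D" and z: "z \<in> D" and \<mu>: "z + \<mu> *s Y \<notin> D"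
  shows "ereal (1 / (32 * norm \<mu>)) \<le> caratheodory_metric D z Y"
proof -
  have openD: "open D" using D by (simp add: C_convex_domain_def)
  have "closed (- line_slice D z Y)"
    using open_line_slice[OF openD] by auto
  moreover have "- line_slice D z Y \<noteq> {}"
    using \<mu> by (auto simp: line_slice_def)
  ultimately obtain \<mu>0 where \<mu>0: "\<mu>0 \<in> - line_slice D z Y"
      "\<And>y. y \<in> - line_slice D z Y \<Longrightarrow> dist 0 \<mu>0 \<le> dist 0 y"
    using distance_attains_inf[of "- line_slice D z Y" 0] by blast
  have \<mu>0_le: "norm \<mu>0 \<le> norm \<mu>"
    using \<mu>0(2)[of \<mu>] \<mu> by (simp add: line_slice_def)
  have \<mu>0_nz: "\<mu>0 \<noteq> 0"
    using \<mu>0(1) z by (auto simp: line_slice_def)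
  have disc: "z + t *s Y \<in> D" if "norm t < norm \<mu>0" for t
    using \<mu>0(2)[of t] that by (force simp: line_slice_def)
  define a where "a = z + \<mu>0 *s Y"
  have "a \<notin> D" using \<mu>0(1) by (simp add: a_def line_slice_def)
  then obtain l where l: "bounded_linear l" "\<And>c v. l (c *s v) = c * l v" "\<And>z. z \<in> D \<Longrightarrow> l (z - a) \<noteq> 0"
    using C_convex_supporting_hyperplane[OF D] by blast
  interpret l: bounded_linear l by (rule l(1))
  have lz: "l (z - a) = - \<mu>0 * l Y"
    by (simp add: a_def linear_neg[OF l.linear] l(2))
  then have lY: "l Y \<noteq> 0" using l(3)[OF z] by auto
  obtain A where A: "continuous_on D A" "\<And>q. q \<in> D \<Longrightarrow> exp (A q) = l (q - a)"
  proof (rule continuous_log_along_lines[OF D continuous_on_const[of D z] z subset_refl l(1)])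
    show "l (z + c *s (x - z) - a) \<noteq> 0" if "c \<in> line_slice D z (x - z)" for x c
      using l(3)[of "z + c *s (x - z)"] that by (auto simp: line_slice_def)
    show "exp (Ln (l (z - a))) = l (z - a)"
      using l(3)[OF z] by simp
    fix A assume "continuous_on D A" "\<And>q. q \<in> D \<Longrightarrow> exp (A q) = l (q - a)"
    then show thesis by (rule that)
  qed
  have derA: "(A has_derivative (\<lambda>v. l v / l (q - a))) (at q)" if "q \<in> D" for q
    by (rule continuous_log_has_derivative[OF openD A(1) l(1) A(2) that])
  define h where "h = (\<lambda>q. exp (A q / 2))"
  define w where "w = h z"
  have w: "w \<noteq> 0" by (simp add: w_def h_def)
  have h_sq: "(h q)\<^sup>2 = l (q - a)" if "q \<in> D" for q
    using A(2)[OF that] by (simp add: h_def power2_eq_square flip: exp_add)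
  \<comment> \<open>The line through \<open>q\<close> and \<open>q'\<close> lies in one level set of
    \<open>l\<close> and meets \<open>D\<close> in a connected set, on which the branch
    \<open>A\<close> must be constant.\<close>
  have h_fibre: "h q = h q'" if "q \<in> D" "q' \<in> D" "l (q - a) = l (q' - a)" for q q'
  proof -
    define C where "C = (\<lambda>c. q' + c *s (q - q')) ` line_slice D q' (q - q')"
    have CD: "C \<subseteq> D" by (auto simp: C_def line_slice_def)
    have "A q - A q' = A q' - A q'"
    proof (rule exp_eq_imp_diff_constant[of C A "\<lambda>_. A q'"])
      show "connected C"
        unfolding C_def
        by (intro connected_continuous_image continuous_on_line simply_connected_imp_connected
            simply_connected_line_slice D)
      show "continuous_on C A" using A(1) CD by (rule continuous_on_subset)
      show "exp (A x) = exp (A q')" if "x \<in> C" for x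
      proof -
        obtain c where c: "x = q' + c *s (q - q')" using \<open>x \<in> C\<close> by (auto simp: C_def)
        have "l (x - a) = l (q' - a) + c * (l (q - a) - l (q' - a))"
          by (simp add: c l(2) l.add l.diff right_diff_distrib)
        then show ?thesis
          using A(2) that CD \<open>q' \<in> D\<close> \<open>l (q - a) = l (q' - a)\<close> by auto
      qed
      show "q \<in> C"
        unfolding C_def by (rule image_eqI[of _ _ 1]) (use \<open>q \<in> D\<close> in \<open>auto simp: line_slice_def\<close>)
      show "q' \<in> C"
        unfolding C_def by (rule image_eqI[of _ _ 0]) (use \<open>q' \<in> D\<close> in \<open>auto simp: line_slice_def\<close>)
    qed auto
    then show ?thesis by (simp add: h_def)
  qed
  have l_disc: "l (z + t *s Y - a) = l (z - a) * (1 - t / \<mu>0)" for t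
  proof -
    have "l (z + t *s Y - a) = l (z - a) + t * l Y"
      by (simp add: l.add l.diff l(2))
    also have "\<dots> = l (z - a) * (1 - t / \<mu>0)"
      using \<mu>0_nz by (simp add: lz field_simps)
    finally show ?thesis .
  qed
  have h_disc: "h (z + t *s Y) = w * csqrt (1 - t / \<mu>0)" if t: "norm t < norm \<mu>0" for t
  proof -
    have nonneg: "1 - t / \<mu>0 \<notin> \<real>\<^sub>\<le>\<^sub>0" if "norm t < norm \<mu>0" for t
    proof -
      have "norm (t / \<mu>0) < 1" using that \<mu>0_nz by (simp add: norm_divide)
      then have "Re (t / \<mu>0) < 1" using complex_Re_le_cmod[of "t / \<mu>0"] by linarith
      then show ?thesis by (auto simp: complex_nonpos_Reals_iff)
    qed
    have "A (z + t *s Y) - (A z + Ln (1 - t / \<mu>0)) = A (z + 0 *s Y) - (A z + Ln (1 - 0 / \<mu>0))"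
    proof (rule exp_eq_imp_diff_constant[of "ball 0 (norm \<mu>0)"])
      show "continuous_on (ball 0 (norm \<mu>0)) (\<lambda>t. A (z + t *s Y))"
        by (rule continuous_on_compose2[OF A(1) continuous_on_line]) (use disc in auto)
      show "continuous_on (ball 0 (norm \<mu>0)) (\<lambda>t. A z + Ln (1 - t / \<mu>0))"
        using nonneg \<mu>0_nz by (intro continuous_intros) auto
      show "exp (A (z + t *s Y)) = exp (A z + Ln (1 - t / \<mu>0))" if "t \<in> ball 0 (norm \<mu>0)" for t
      proof -
        have "1 - t / \<mu>0 \<noteq> 0" using nonneg[of t] that by auto
        then show ?thesis
          using that disc[of t] z by (simp add: exp_add A(2) l_disc)
      qed
    qed (use t \<mu>0_nz in auto)
    then have "A (z + t *s Y) = A z + Ln (1 - t / \<mu>0)" by simp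
    moreover have "1 - t / \<mu>0 \<noteq> 0" using nonneg[OF t] by auto
    ultimately show ?thesis
      by (simp add: h_def w_def csqrt_exp_Ln add_divide_distrib exp_add)
  qed
  \<comment> \<open>Values of \<open>h\<close> near \<open>- w\<close> would be the negatives of values of \<open>h\<close> on the disc, with the same \<open>l\<close>.\<close>
  have omit: "2 / 5 * norm w \<le> norm (h q + w)" if q: "q \<in> D" for q
  proof (rule ccontr)
    assume "\<not> ?thesis"
    then have less: "norm (h q + w) < 2 / 5 * norm w" by simp
    define s where "s = - (h q + w) / w"
    have hq: "h q = - (w * (1 + s))" using w by (simp add: s_def field_simps)
    have "norm s = norm (h q + w) / norm w"
      by (simp only: s_def norm_divide norm_minus_cancel)
    then have s: "norm s < 2 / 5" using less w by (simp add: pos_divide_less_eq)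
    \<comment> \<open>\<open>t\<close> solves \<open>1 - t / \<mu>0 = (1 + s)^2\<close>. The radius
      \<open>2 / 5\<close> is admissible since \<open>2 * (2/5) + (2/5)^2 = 24/25 < 1\<close> keeps
      \<open>t\<close> in the inscribed disc.\<close>
    define t where "t = - (2 * s + s\<^sup>2) * \<mu>0"
    have "norm (2 * s + s\<^sup>2) \<le> 2 * norm s + norm s * norm s"
      by (rule order_trans[OF norm_triangle_ineq]) (simp add: norm_mult power2_eq_square)
    also have "\<dots> \<le> 2 * (2/5) + 2/5 * (2/5)"
      using s by (intro add_mono mult_mono) auto
    also have "\<dots> < 1" by simp
    finally have less1: "norm (2 * s + s\<^sup>2) < 1" .
    have "norm t = norm (2 * s + s\<^sup>2) * norm \<mu>0"
      by (simp only: t_def norm_mult norm_minus_cancel)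
    also have "\<dots> < norm \<mu>0" using less1 \<mu>0_nz by simp
    finally have "norm t < norm \<mu>0" .
    moreover have t': "1 - t / \<mu>0 = (1 + s)\<^sup>2"
    proof -
      have "t / \<mu>0 = - (2 * s + s\<^sup>2)" using \<mu>0_nz by (simp add: t_def)
      then show ?thesis by (simp add: power2_eq_square algebra_simps)
    qed
    moreover have "0 < Re (1 + s)"
      using s abs_Re_le_cmod[of s] by simp
    ultimately have h': "h (z + t *s Y) = w * (1 + s)" and q': "z + t *s Y \<in> D"
      using h_disc[of t] disc[of t] by (simp_all add: csqrt_square)
    have "(h (z + t *s Y))\<^sup>2 = (h q)\<^sup>2" unfolding h' hq by simp
    then have "h q = h (z + t *s Y)"
      using q q' by (intro h_fibre) (simp_all add: h_sq)
    then have "w * (1 + s) = 0" using h' hq by simp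
    then show False using w \<open>0 < Re (1 + s)\<close> by auto
  qed
  \<comment> \<open>At \<open>z\<close> the exponential is \<open>w\<close>, so the quotient is
    \<open>1 / 8\<close> and the subtraction gives \<open>f z = 0\<close>. By \<open>omit\<close>
    the quotient is at most \<open>5 / 8\<close> in modulus, hence \<open>f\<close> is at most
    \<open>3 / 4\<close>. The factor \<open>1 / 32\<close> is
    \<open>(1/4) * (1/2) / 4\<close>.\<close>
  define \<Psi> where "\<Psi> = (\<lambda>x. (w / 4) / (exp (x / 2) + w) - 1 / 8)"
  define f where "f = (\<lambda>q. \<Psi> (A q))"
  have hw: "h q + w \<noteq> 0" if "q \<in> D" for q
    using omit[OF that] w by auto
  have derf: "(f has_derivative (\<lambda>v. - (w / 4) * (h q / 2) / (h q + w)\<^sup>2 * (l v / l (q - a)))) (at q)"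
    if q: "q \<in> D" for q
  proof -
    have "((\<lambda>x. exp (x / 2) + w) has_field_derivative h q / 2) (at (A q))"
      unfolding h_def by (auto intro!: derivative_eq_intros)
    moreover have "exp (A q / 2) + w \<noteq> 0" using hw[OF q] by (simp add: h_def)
    ultimately have "((\<lambda>x. inverse (exp (x / 2) + w)) has_field_derivative
        - (inverse (exp (A q / 2) + w) * (h q / 2) * inverse (exp (A q / 2) + w))) (at (A q))"
      by (rule DERIV_inverse')
    from DERIV_diff[OF DERIV_cmult[OF this, of "w / 4"] DERIV_const[of "1 / 8"]]
    have "(\<Psi> has_field_derivative - (w / 4) * (h q / 2) / (h q + w)\<^sup>2) (at (A q))"
      unfolding \<Psi>_def divide_inverse[of "w / 4"]
    proof (rule DERIV_cong)
      have "c * - (inverse e * k * inverse e) - 0 = - c * k / e\<^sup>2" for c k e :: complex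
        by (simp add: divide_inverse power2_eq_square ac_simps)
      then show "w / 4 * - (inverse (exp (A q / 2) + w) * (h q / 2) * inverse (exp (A q / 2) + w)) - 0
          = - (w / 4) * (h q / 2) / (h q + w)\<^sup>2"
        by (simp only: h_def)
    qed
    then show ?thesis
      unfolding f_def has_field_derivative_def by (rule has_derivative_compose[OF derA[OF q]])
  qed
  have "holomorphic_fun_on f D"
    unfolding holomorphic_fun_on_def
    by (intro ballI exI conjI, erule derf) (simp add: l(2))
  moreover have "f ` D \<subseteq> ball 0 1"
  proof clarify
    fix q assume q: "q \<in> D"
    have "norm ((w / 4) / (h q + w)) = (norm w / 4) / norm (h q + w)"
      by (simp only: norm_divide norm_numeral)
    also have "\<dots> \<le> (norm w / 4) / (2 / 5 * norm w)"
      using omit[OF q] w by (intro divide_left_mono mult_pos_pos) (auto simp: hw[OF q])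
    also have "\<dots> = 5 / 8" using w by simp
    finally have "norm ((w / 4) / (h q + w) - 1 / 8) \<le> 5 / 8 + 1 / 8"
      by (intro order_trans[OF norm_triangle_ineq4] add_mono) auto
    then show "f q \<in> ball 0 1" by (simp add: f_def \<Psi>_def h_def)
  qed
  moreover have "f z = 0"
    using w by (simp add: f_def \<Psi>_def flip: h_def w_def) (simp add: w_def h_def)
  moreover have "norm (frechet_derivative f (at z) Y) = 1 / (32 * norm \<mu>0)"
  proof -
    have "frechet_derivative f (at z) Y = - (w / 4) * (w / 2) / (w + w)\<^sup>2 * (l Y / l (z - a))"
      using frechet_derivative_at[OF derf[OF z]] by (metis w_def)
    also have "\<dots> = 1 / (32 * \<mu>0)"
      using w lY \<mu>0_nz by (simp add: lz field_simps power2_eq_square)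
    finally show ?thesis by (simp add: norm_divide norm_mult)
  qed
  ultimately have "ereal (1 / (32 * norm \<mu>0)) \<le> caratheodory_metric D z Y"
    unfolding caratheodory_metric_def by (intro Sup_upper) force
  moreover have "1 / (32 * norm \<mu>) \<le> 1 / (32 * norm \<mu>0)"
    using \<mu>0_le \<mu>0_nz by (intro divide_left_mono mult_pos_pos) auto
  ultimately show ?thesis by (meson ereal_less_eq(3) order_trans)
qed

lemma kobayashi_metric_le_disc:
  fixes D :: "(complex^'n) set"
  assumes \<rho>: "\<rho> > 0" and disc: "\<And>t. norm t < \<rho> \<Longrightarrow> z + t *s X \<in> D"
  shows "kobayashi_metric D z X \<le> ereal (1 / \<rho>)"
proof -
  define \<phi> where "\<phi> = (\<lambda>\<zeta>. z + (of_real \<rho> * \<zeta>) *s X)"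
  have comp: "\<phi> \<zeta> $ i = z $ i + of_real \<rho> * \<zeta> * X $ i" for \<zeta> i
    by (simp add: \<phi>_def)
  have "holomorphic_disc \<phi>"
    unfolding holomorphic_disc_def comp by (auto intro!: holomorphic_intros)
  moreover have "\<phi> ` ball 0 1 \<subseteq> D"
    using \<rho> by (auto simp: \<phi>_def norm_mult intro!: disc)
  moreover have "\<phi> 0 = z" by (simp add: \<phi>_def)
  moreover have "deriv (\<lambda>\<zeta>. \<phi> \<zeta> $ i) 0 = of_real \<rho> * X $ i" for i
    unfolding comp by (rule DERIV_imp_deriv) (auto intro!: derivative_eq_intros)
  then have "(1 / \<rho>) *\<^sub>R (\<chi> i. deriv (\<lambda>\<zeta>. \<phi> \<zeta> $ i) 0) = X"
    using \<rho> by (simp add: vec_eq_iff scaleR_conv_of_real[where 'a = complex])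
  ultimately show ?thesis
    unfolding kobayashi_metric_def using \<rho>
    by (intro Inf_lower CollectI exI[of _ "1 / \<rho>"] exI[of _ \<phi>] conjI) auto
qed

lemma caratheodory_metric_le_iff:
  "caratheodory_metric D z X \<le> ereal K \<longleftrightarrow>
     (\<forall>f. holomorphic_fun_on f D \<and> f ` D \<subseteq> ball 0 1 \<and> f z = 0 \<longrightarrow>
        norm (frechet_derivative f (at z) X) \<le> K)"
  unfolding caratheodory_metric_def Sup_le_iff by (auto simp del: image_subset_iff)

text \<open>The Schwarz lemma is applied to each competitor along the affine disc in direction
  \<open>X\<close>.\<close>

lemma caratheodory_metric_le_disc:
  fixes D :: "(complex^'n) set"
  assumes \<rho>: "\<rho> > 0" and disc: "\<And>t. norm t < \<rho> \<Longrightarrow> z + t *s X \<in> D"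
  shows "caratheodory_metric D z X \<le> ereal (1 / \<rho>)"
  unfolding caratheodory_metric_le_iff
proof (intro allI impI)
  fix f :: "complex^'n \<Rightarrow> complex"
  assume f: "holomorphic_fun_on f D \<and> f ` D \<subseteq> ball 0 1 \<and> f z = 0"
  define \<phi> where "\<phi> = (\<lambda>\<zeta>. z + (of_real \<rho> * \<zeta>) *s X)"
  have \<phi>D: "\<phi> \<zeta> \<in> D" if "norm \<zeta> < 1" for \<zeta>
    using \<rho> that by (auto simp: \<phi>_def norm_mult intro!: disc)
  have "bounded_linear (\<lambda>\<zeta>. (of_real \<rho> * \<zeta>) *s X)"
    by (rule bounded_linear_intro[of _ "\<rho> * norm X"])
       (auto simp: vec_eq_iff algebra_simps scaleR_conv_of_real[where 'a = complex]
          norm_vector_scalar_mult norm_mult \<rho> less_imp_le)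
  then have der\<phi>: "(\<phi> has_derivative (\<lambda>\<zeta>. (of_real \<rho> * \<zeta>) *s X)) (at \<zeta>)" for \<zeta>
    unfolding \<phi>_def by (auto intro!: derivative_eq_intros bounded_linear_imp_has_derivative)
  have der: "((\<lambda>\<zeta>. f (\<phi> \<zeta>)) has_field_derivative of_real \<rho> * f' X) (at \<zeta>)"
    if "(f has_derivative f') (at (\<phi> \<zeta>))" "\<forall>c v. f' (c *s v) = c * f' v" for f' \<zeta>
  proof -
    have "(\<lambda>t. f' ((of_real \<rho> * t) *s X)) = (*) (of_real \<rho> * f' X)"
      using that(2) by (auto simp: fun_eq_iff)
    then show ?thesis
      using has_derivative_compose[OF der\<phi> that(1)] by (simp add: has_field_derivative_def)
  qed
  have "(\<lambda>\<zeta>. f (\<phi> \<zeta>)) holomorphic_on ball 0 1"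
    unfolding holomorphic_on_open[OF open_ball]
    using der \<phi>D f unfolding holomorphic_fun_on_def by (metis dist_0_norm mem_ball)
  moreover have "norm (f (\<phi> \<zeta>)) < 1" if "norm \<zeta> < 1" for \<zeta>
    using f \<phi>D[OF that] by (auto simp: image_subset_iff)
  moreover have \<phi>0: "\<phi> 0 = z" by (simp add: \<phi>_def)
  ultimately have "norm (deriv (\<lambda>\<zeta>. f (\<phi> \<zeta>)) 0) \<le> 1"
    using f by (intro Schwarz_Lemma(2)[of _ 0]) auto
  moreover obtain f' where f': "(f has_derivative f') (at z)" "\<forall>c v. f' (c *s v) = c * f' v"
    using f \<phi>D[of 0] \<phi>0 unfolding holomorphic_fun_on_def by auto
  then have "deriv (\<lambda>\<zeta>. f (\<phi> \<zeta>)) 0 = of_real \<rho> * f' X"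
    using der[of f' 0] \<phi>0 by (auto intro: DERIV_imp_deriv)
  moreover have "frechet_derivative f (at z) = f'"
    using frechet_derivative_at[OF f'(1)] by simp
  ultimately show "norm (frechet_derivative f (at z) X) \<le> 1 / \<rho>"
    using \<rho> by (simp add: norm_mult field_simps)
qed

text \<open>The derivative of each competitor is linear in the direction, so bounds add up. The
  Kobayashi metric has no such structure in general, which is why bounds on basis vectors pass
  through the Caratheodory metric.\<close>

lemma caratheodory_metric_linear_combination_le:
  fixes D :: "(complex^'n) set" and b :: "'i \<Rightarrow> complex^'n"
  assumes "z \<in> D" "\<And>i. i \<in> I \<Longrightarrow> caratheodory_metric D z (b i) \<le> ereal (K i)"
  shows "caratheodory_metric D z (\<Sum>i\<in>I. c i *\<^sub>R b i) \<le> ereal (\<Sum>i\<in>I. \<bar>c i\<bar> * K i)"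
  unfolding caratheodory_metric_le_iff
proof (intro allI impI)
  fix f :: "complex^'n \<Rightarrow> complex"
  assume f: "holomorphic_fun_on f D \<and> f ` D \<subseteq> ball 0 1 \<and> f z = 0"
  define f' where "f' = frechet_derivative f (at z)"
  have "f differentiable (at z)"
    using f assms(1) by (auto simp: holomorphic_fun_on_def differentiable_def)
  then have lin: "linear f'"
    unfolding f'_def by (rule linear_frechet_derivative)
  have bound: "norm (f' (b i)) \<le> K i" if "i \<in> I" for i
    using assms(2)[OF that] f unfolding caratheodory_metric_le_iff f'_def by blast
  have "norm (f' (\<Sum>i\<in>I. c i *\<^sub>R b i)) = norm (\<Sum>i\<in>I. c i *\<^sub>R f' (b i))"
    by (simp add: linear_sum[OF lin] linear_cmul[OF lin])
  also have "\<dots> \<le> (\<Sum>i\<in>I. \<bar>c i\<bar> * K i)"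
    by (intro sum_norm_le) (auto intro!: mult_left_mono bound)
  finally show "norm (frechet_derivative f (at z) (\<Sum>i\<in>I. c i *\<^sub>R b i)) \<le> (\<Sum>i\<in>I. \<bar>c i\<bar> * K i)"
    by (simp add: f'_def)
qed

text \<open>It suffices that lines from \<open>z\<close> near \<open>a\<close> in directions near
  \<open>X\<close> leave \<open>D\<close> within distance \<open>\<rho>\<close> of the parameter 0.
  If \<open>l X \<noteq> 0\<close> they cross the hyperplane missing \<open>D\<close>. Otherwise the
  line through \<open>a\<close> lies in that hyperplane, and as \<open>X\<close> is not a boundary
  disc direction, some point of it is outside the closure of \<open>D\<close>; this persists under
  perturbation.\<close>

lemma C_convex_caratheodory_tendsto_infinity:
  fixes D :: "(complex^'n) set"
  assumes D: "C_convex_domain D" and a: "a \<in> frontier D"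
    and X: "X \<notin> boundary_disc_directions D a" and M: "M > 0"
  obtains U V where "open U" "a \<in> U" "open V" "X \<in> V"
    "\<And>z Y. z \<in> D \<inter> U \<Longrightarrow> Y \<in> V \<Longrightarrow> caratheodory_metric D z Y > ereal M"
proof -
  have openD: "open D" using D by (simp add: C_convex_domain_def)
  then have aD: "a \<notin> D" using a by (simp add: frontier_def interior_open)
  \<comment> \<open>This makes \<open>1 / (32 * \<rho>) = 2 * M\<close>, which leaves room for the
    strict inequality.\<close>
  define \<rho> where "\<rho> = 1 / (64 * M)"
  have \<rho>: "\<rho> > 0" using M by (simp add: \<rho>_def)
  obtain l where l: "bounded_linear l" "\<And>c v. l (c *s v) = c * l v" "\<And>z. z \<in> D \<Longrightarrow> l (z - a) \<noteq> 0"
    using C_convex_supporting_hyperplane[OF D aD] by blast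
  interpret l: bounded_linear l by (rule l(1))
  have escape: "\<exists>W. open W \<and> (a, X) \<in> W \<and> (\<forall>z Y. (z, Y) \<in> W \<longrightarrow> (\<exists>\<mu>. norm \<mu> < \<rho> \<and> z + \<mu> *s Y \<notin> D))"
  proof (cases "l X = 0")
    case True
    have "\<not> {a + c *s X |c. norm c < \<rho>} \<subseteq> frontier D"
      using X \<rho> unfolding boundary_disc_directions_def by auto
    then obtain c where c: "norm c < \<rho>" "a + c *s X \<notin> frontier D" by auto
    have "a + c *s X \<notin> D"
      using l(3)[of "a + c *s X"] True by (auto simp: l(2))
    then have "a + c *s X \<notin> closure D"
      using c(2) openD by (simp add: frontier_def interior_open)
    moreover have "open ((\<lambda>(z, Y). z + c *s Y) -` (- closure D))"
      unfolding case_prod_unfold by (intro open_vimage) (auto intro!: continuous_intros)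
    ultimately show ?thesis
      using c(1) closure_subset[of D]
      by (intro exI[of _ "(\<lambda>(z, Y). z + c *s Y) -` (- closure D)"]) auto
  next
    case False
    define W where "W = {p. norm (l (fst p - a)) < \<rho> * norm (l (snd p))}"
    have "open W"
      unfolding W_def by (intro open_Collect_less continuous_intros l.continuous_on)
    moreover have "(a, X) \<in> W" using False \<rho> by (simp add: W_def)
    moreover have "\<exists>\<mu>. norm \<mu> < \<rho> \<and> z + \<mu> *s Y \<notin> D" if "(z, Y) \<in> W" for z Y
    proof -
      have less: "norm (l (z - a)) < \<rho> * norm (l Y)" using that by (simp add: W_def)
      then have nz: "l Y \<noteq> 0" by auto
      define \<mu> where "\<mu> = - l (z - a) / l Y"
      have "l (z + \<mu> *s Y - a) = 0"
        using nz by (simp add: l.add l.diff l(2) \<mu>_def)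
      then have "z + \<mu> *s Y \<notin> D" using l(3) by blast
      moreover have "norm \<mu> = norm (l (z - a)) / norm (l Y)"
        by (simp only: \<mu>_def norm_divide norm_minus_cancel)
      then have "norm \<mu> < \<rho>" using less nz by (simp add: pos_divide_less_eq)
      ultimately show ?thesis by blast
    qed
    ultimately show ?thesis by blast
  qed
  then obtain W where W: "open W" "(a, X) \<in> W"
      "\<And>z Y. (z, Y) \<in> W \<Longrightarrow> \<exists>\<mu>. norm \<mu> < \<rho> \<and> z + \<mu> *s Y \<notin> D"
    by metis
  obtain U V where "open U" "open V" "(a, X) \<in> U \<times> V" and UVW: "U \<times> V \<subseteq> W"
    by (rule open_prod_elim[OF W(1,2)])
  then have UV: "open U" "a \<in> U" "open V" "X \<in> V" by auto
  show thesis
  proof (rule that[OF UV])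
    fix z Y assume z: "z \<in> D \<inter> U" and Y: "Y \<in> V"
    then obtain \<mu> where \<mu>: "norm \<mu> < \<rho>" "z + \<mu> *s Y \<notin> D"
      using W(3) UVW by blast
    then have "\<mu> \<noteq> 0" using z by auto
    then have "1 / (32 * norm \<mu>) \<ge> 1 / (32 * \<rho>)"
      using \<mu>(1) \<rho> by (intro divide_left_mono) auto
    moreover have "1 / (32 * \<rho>) = 2 * M" using M by (simp add: \<rho>_def)
    ultimately have "M < 1 / (32 * norm \<mu>)" using M by linarith
    also have "ereal (1 / (32 * norm \<mu>)) \<le> caratheodory_metric D z Y"
      using C_convex_caratheodory_lower_bound[OF D _ \<mu>(2)] z by blast
    finally show "caratheodory_metric D z Y > ereal M" by simp
  qed
qed

subsection \<open>Boundary discs at a smooth boundary point\<close>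

text \<open>Translating the boundary disc by \<open>z - a\<close> moves it in a direction in which
  \<open>r\<close> strictly decreases, uniformly near \<open>a\<close>.\<close>

lemma C1_boundary_disc_translate_along_cone:
  fixes D :: "(complex^'n) set"
  assumes r: "C1_defining_function D U r g" and a: "a \<in> U" and D: "open D"
    and X: "X \<in> boundary_disc_directions D a" and \<theta>: "\<theta> > 0"
  obtains \<epsilon> \<delta> where "\<epsilon> > 0" "\<delta> > 0"
    "\<And>z t. z \<in> nontangential_cone a (- (g a /\<^sub>R norm (g a))) \<theta> \<Longrightarrow> z \<in> ball a \<delta> \<Longrightarrow> z \<noteq> a \<Longrightarrow>
       norm t < \<epsilon> \<Longrightarrow> z + t *s X \<in> D"
proof -
  have U: "open U" "D \<inter> U = {z\<in>U. r z < 0}" "continuous_on U g"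
    and der: "\<And>z. z \<in> U \<Longrightarrow> (r has_derivative (\<lambda>v. g z \<bullet> v)) (at z)" and ga: "g a \<noteq> 0"
    using r a by (auto simp: C1_defining_function_def)
  have "isCont g a" using U(1,3) a by (simp add: continuous_on_eq_continuous_at)
  then obtain \<eta>0 where \<eta>0: "\<eta>0 > 0" "\<And>x. dist x a < \<eta>0 \<Longrightarrow> dist (g x) (g a) < norm (g a) * \<theta>"
    using ga \<theta> unfolding continuous_at_eps_delta by (metis mult_pos_pos zero_less_norm_iff)
  obtain \<eta>1 where \<eta>1: "\<eta>1 > 0" "ball a \<eta>1 \<subseteq> U"
    using U(1) a open_contains_ball by blast
  define \<eta> where "\<eta> = min \<eta>0 \<eta>1"
  have \<eta>: "\<eta> > 0" "\<And>x. x \<in> ball a \<eta> \<Longrightarrow> norm (g x - g a) < norm (g a) * \<theta>" "ball a \<eta> \<subseteq> U"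
    using \<eta>0 \<eta>1 by (auto simp: \<eta>_def dist_norm norm_minus_commute)
  obtain \<epsilon>0 where \<epsilon>0: "\<epsilon>0 > 0" "\<And>t. norm t < \<epsilon>0 \<Longrightarrow> a + t *s X \<in> frontier D"
    using X unfolding boundary_disc_directions_def by blast
  \<comment> \<open>Half of \<open>\<eta>\<close> is reserved for \<open>t *s X\<close> and half for
    \<open>z - a\<close>, so the segment from \<open>a + t *s X\<close> to \<open>z + t *s X\<close>
    stays where the gradient is controlled.\<close>
  define \<epsilon> where "\<epsilon> = min \<epsilon>0 (\<eta> / 2 / (norm X + 1))"
  have nX: "norm X + 1 > 0" by (simp add: add_nonneg_pos)
  show thesis
  proof (rule that[of \<epsilon> "\<eta> / 2"])
    show "\<epsilon> > 0" "\<eta> / 2 > 0" using \<epsilon>0(1) \<eta>(1) nX by (simp_all add: \<epsilon>_def)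
    fix z and t :: complex
    assume z: "z \<in> nontangential_cone a (- (g a /\<^sub>R norm (g a))) \<theta>" "z \<in> ball a (\<eta> / 2)" "z \<noteq> a"
      and t: "norm t < \<epsilon>"
    define v where "v = z - a"
    define b where "b = a + t *s X"
    have v: "v \<noteq> 0" "norm v < \<eta> / 2"
      using z by (auto simp: v_def dist_norm norm_minus_commute)
    have "\<theta> * norm v \<le> v \<bullet> (- (g a /\<^sub>R norm (g a)))"
      using z(1) by (auto simp: nontangential_cone_def v_def)
    then have ga_v: "g a \<bullet> v \<le> - (norm (g a) * \<theta>) * norm v"
      using ga by (simp add: inner_commute field_simps)
    have neg: "g x \<bullet> v < 0" if "x \<in> ball a \<eta>" for x
    proof -
      have "(g x - g a) \<bullet> v \<le> norm (g x - g a) * norm v" by (rule norm_cauchy_schwarz)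
      also have "\<dots> < norm (g a) * \<theta> * norm v" using \<eta>(2)[OF that] v by simp
      finally show ?thesis using ga_v by (simp add: inner_diff_left)
    qed
    have "norm (t *s X) < \<eta> / 2"
    proof -
      have "norm (t *s X) \<le> norm t * (norm X + 1)"
        by (simp add: norm_vector_scalar_mult mult_left_mono)
      also have "norm t < \<eta> / 2 / (norm X + 1)" using t by (simp add: \<epsilon>_def)
      then have "norm t * (norm X + 1) < \<eta> / 2" by (simp only: pos_less_divide_eq[OF nX])
      finally show ?thesis .
    qed
    then have near: "b + s *\<^sub>R v \<in> ball a \<eta>" if "0 \<le> s" "s \<le> 1" for s
    proof -
      have "norm (s *\<^sub>R v) \<le> norm v" using that by (simp add: mult_left_le_one_le)
      then have "norm (t *s X + s *\<^sub>R v) < \<eta>"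
        using \<open>norm (t *s X) < \<eta> / 2\<close> v(2) norm_triangle_ineq[of "t *s X" "s *\<^sub>R v"] by linarith
      moreover have "a - (b + s *\<^sub>R v) = - (t *s X + s *\<^sub>R v)" by (simp add: b_def)
      ultimately show ?thesis by (simp only: mem_ball dist_norm norm_minus_cancel)
    qed
    have bU: "b \<in> U" using near[of 0] \<eta>(3) by auto
    \<comment> \<open>A point with \<open>r b > 0\<close> would have a neighbourhood free of
      \<open>D\<close>, but \<open>b\<close> is in the closure of \<open>D\<close>.\<close>
    have "r b \<le> 0"
    proof (rule ccontr)
      assume "\<not> r b \<le> 0"
      moreover have "isCont r b" using der[OF bU] has_derivative_continuous by blast
      ultimately have "\<forall>\<^sub>F x in nhds b. 0 < r x"
        using order_tendstoD(1)[of r "r b" "nhds b" 0] by (simp add: isCont_def tendsto_at_iff_tendsto_nhds)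
      moreover have "\<forall>\<^sub>F x in nhds b. x \<in> U" using U(1) bU by (rule eventually_nhds_in_open)
      ultimately have "\<forall>\<^sub>F x in nhds b. x \<notin> D"
        by eventually_elim (use U(2) in force)
      moreover have "b \<in> closure D"
        using \<epsilon>0(2)[of t] t by (auto simp: b_def \<epsilon>_def frontier_def)
      ultimately show False
        unfolding eventually_nhds_metric closure_approachable by blast
    qed
    have "r (b + 1 *\<^sub>R v) < r (b + 0 *\<^sub>R v)"
    proof (rule DERIV_neg_imp_decreasing[of 0 1 "\<lambda>s. r (b + s *\<^sub>R v)"])
      fix s :: real assume s: "0 \<le> s" "s \<le> 1"
      have "b + s *\<^sub>R v \<in> U" using near[OF s] \<eta>(3) by blast
      have "((\<lambda>s. b + s *\<^sub>R v) has_derivative (\<lambda>s. s *\<^sub>R v)) (at s)"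
        by (auto intro!: derivative_eq_intros)
      from has_derivative_compose[OF this der[OF \<open>b + s *\<^sub>R v \<in> U\<close>]]
      have "((\<lambda>s. r (b + s *\<^sub>R v)) has_real_derivative g (b + s *\<^sub>R v) \<bullet> v) (at s)"
        by (simp add: has_field_derivative_def mult.commute[of _ "g (b + s *\<^sub>R v) \<bullet> v"])
      then show "\<exists>y. ((\<lambda>s. r (b + s *\<^sub>R v)) has_real_derivative y) (at s) \<and> y < 0"
        using neg[OF near[OF s]] by blast
    qed simp
    then have "r (b + v) < 0" using \<open>r b \<le> 0\<close> by simp
    moreover have "b + v \<in> U" using near[of 1] \<eta>(3) by auto
    ultimately have "b + v \<in> D" using U(2) by auto
    then show "z + t *s X \<in> D" by (simp add: b_def v_def add.commute add.left_commute)
  qed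
qed

text \<open>For sums, discs of fixed radii in directions \<open>X\<close> and \<open>Y\<close> fit
  into \<open>D\<close> at points of the inner normal near \<open>a\<close>. This bounds the
  Caratheodory metric in direction \<open>X + Y\<close>, whereas it would blow up if
  \<open>X + Y\<close> were not a boundary disc direction.\<close>

lemma subspace_boundary_disc_directions:
  fixes D :: "(complex^'n) set"
  assumes D: "C_convex_domain D" and a: "a \<in> frontier D" and C1: "C1_smooth_at D a"
  shows "vec.subspace (boundary_disc_directions D a)"
proof (rule vec.subspaceI)
  let ?L = "boundary_disc_directions D a"
  have openD: "open D" using D by (simp add: C_convex_domain_def)
  obtain U r g where r: "C1_defining_function D U r g" and aU: "a \<in> U"
    using C1 by (auto simp: C1_smooth_at_def)
  define \<nu> where "\<nu> = - (g a /\<^sub>R norm (g a))"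
  have \<nu>: "norm \<nu> = 1"
    using r aU by (simp add: \<nu>_def C1_defining_function_def)
  show "0 \<in> ?L"
    using a by (auto simp: boundary_disc_directions_def intro!: exI[of _ 1])
  show "c *s X \<in> ?L" if X: "X \<in> ?L" for c X
  proof -
    obtain \<epsilon> where \<epsilon>: "\<epsilon> > 0" "\<And>t. norm t < \<epsilon> \<Longrightarrow> a + t *s X \<in> frontier D"
      using X unfolding boundary_disc_directions_def by blast
    have c: "norm c + 1 > 0" by (simp add: add_nonneg_pos)
    have "a + t *s (c *s X) \<in> frontier D" if "norm t < \<epsilon> / (norm c + 1)" for t
    proof -
      have "norm (t * c) \<le> norm t * (norm c + 1)" by (simp add: norm_mult mult_left_mono)
      also have "\<dots> < \<epsilon>" using that c by (simp add: pos_less_divide_eq)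
      finally show ?thesis using \<epsilon>(2)[of "t * c"] by (simp add: vector_smult_assoc)
    qed
    then show ?thesis
      using \<epsilon>(1) c unfolding boundary_disc_directions_def
      by (intro CollectI exI[of _ "\<epsilon> / (norm c + 1)"]) auto
  qed
  show "X + Y \<in> ?L" if X: "X \<in> ?L" and Y: "Y \<in> ?L" for X Y
  proof (rule ccontr)
    assume XY: "X + Y \<notin> ?L"
    obtain \<epsilon>1 \<delta>1 where 1: "\<epsilon>1 > 0" "\<delta>1 > 0"
      "\<And>z t. z \<in> nontangential_cone a \<nu> (1/2) \<Longrightarrow> z \<in> ball a \<delta>1 \<Longrightarrow> z \<noteq> a \<Longrightarrow>
        norm t < \<epsilon>1 \<Longrightarrow> z + t *s X \<in> D"
      unfolding \<nu>_def
      by (rule C1_boundary_disc_translate_along_cone[OF r aU openD X, of "1/2"]) auto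
    obtain \<epsilon>2 \<delta>2 where 2: "\<epsilon>2 > 0" "\<delta>2 > 0"
      "\<And>z t. z \<in> nontangential_cone a \<nu> (1/2) \<Longrightarrow> z \<in> ball a \<delta>2 \<Longrightarrow> z \<noteq> a \<Longrightarrow>
        norm t < \<epsilon>2 \<Longrightarrow> z + t *s Y \<in> D"
      unfolding \<nu>_def
      by (rule C1_boundary_disc_translate_along_cone[OF r aU openD Y, of "1/2"]) auto
    define M where "M = 1 / \<epsilon>1 + 1 / \<epsilon>2"
    have "M > 0" using 1(1) 2(1) by (simp add: M_def add_pos_pos)
    then obtain U' V where U': "open U'" "a \<in> U'" "X + Y \<in> V"
      "\<And>z Y. z \<in> D \<inter> U' \<Longrightarrow> Y \<in> V \<Longrightarrow> caratheodory_metric D z Y > ereal M"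
      using C_convex_caratheodory_tendsto_infinity[OF D a XY] by metis
    obtain e where e: "e > 0" "ball a e \<subseteq> U'"
      using U'(1,2) open_contains_ball by blast
    define s where "s = min e (min \<delta>1 \<delta>2) / 2"
    have s: "s > 0" "s < e" "s < \<delta>1" "s < \<delta>2"
      using e(1) 1(2) 2(2) by (auto simp: s_def)
    define z where "z = a + s *\<^sub>R \<nu>"
    have dz: "dist a z = s" using s(1) \<nu> by (simp add: z_def dist_norm)
    have cone: "z \<in> nontangential_cone a \<nu> (1/2)"
      using s(1) \<nu> by (auto simp: z_def nontangential_cone_def simp flip: power2_norm_eq_inner)
    have "z \<noteq> a" using dz s(1) by auto
    have zX: "z + t *s X \<in> D" if "norm t < \<epsilon>1" for t
      using 1(3)[OF cone _ \<open>z \<noteq> a\<close> that] dz s by simp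
    have zY: "z + t *s Y \<in> D" if "norm t < \<epsilon>2" for t
      using 2(3)[OF cone _ \<open>z \<noteq> a\<close> that] dz s by simp
    have zD: "z \<in> D" using zX[of 0] 1(1) by simp
    have cX: "caratheodory_metric D z X \<le> ereal (1 / \<epsilon>1)"
      using 1(1) zX by (rule caratheodory_metric_le_disc)
    have cY: "caratheodory_metric D z Y \<le> ereal (1 / \<epsilon>2)"
      using 2(1) zY by (rule caratheodory_metric_le_disc)
    \<comment> \<open>The booleans serve as the index set of a two-term combination.\<close>
    have "caratheodory_metric D z (\<Sum>i\<in>UNIV. 1 *\<^sub>R (if i then X else Y))
        \<le> ereal (\<Sum>i\<in>UNIV. \<bar>1\<bar> * (if i then 1 / \<epsilon>1 else 1 / \<epsilon>2))"
      by (rule caratheodory_metric_linear_combination_le[OF zD]) (use cX cY in auto)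
    then have "caratheodory_metric D z (X + Y) \<le> ereal M"
      by (simp add: UNIV_bool M_def add.commute)
    moreover have "caratheodory_metric D z (X + Y) > ereal M"
      using U'(3,4) zD e(2) dz s(2) by auto
    ultimately show False by simp
  qed
qed

text \<open>Unit vectors have coefficients of modulus at most 1 in an orthonormal basis, so the sum
  \<open>K\<close> of the basis bounds controls the Caratheodory metric. The lower bound then forces
  a disc of fixed radius \<open>\<rho>\<close> into \<open>D\<close>.\<close>

lemma C_convex_kobayashi_bounded_on_cone:
  fixes D :: "(complex^'n) set"
  assumes D: "C_convex_domain D" and a: "a \<in> frontier D"
    and \<nu>: "inner_unit_normal D a \<nu>" and \<theta>: "\<theta> > 0"
  obtains c \<delta> where "c > 0" "\<delta> > 0"
    "\<And>z X. z \<in> D \<inter> nontangential_cone a \<nu> \<theta> \<inter> ball a \<delta> \<Longrightarrow>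
       X \<in> boundary_disc_directions D a \<Longrightarrow> norm X = 1 \<Longrightarrow> kobayashi_metric D z X \<le> ereal c"
proof -
  let ?L = "boundary_disc_directions D a"
  have openD: "open D" using D by (simp add: C_convex_domain_def)
  have aD: "a \<notin> D" using a openD by (simp add: frontier_def interior_open)
  obtain U r g where r: "C1_defining_function D U r g" and aU: "a \<in> U" and \<nu>_eq: "\<nu> = - (g a /\<^sub>R norm (g a))"
    using \<nu> by (auto simp: inner_unit_normal_def)
  have vec_sub: "vec.subspace ?L"
    using r aU by (intro subspace_boundary_disc_directions D a) (auto simp: C1_smooth_at_def)
  \<comment> \<open>The inner product is the real one, so the basis is taken over the reals.\<close>
  have "subspace ?L"
  proof (rule subspaceI)
    fix s :: real and X :: "complex^'n" assume "X \<in> ?L"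
    then have "of_real s *s X \<in> ?L" by (rule vec.subspace_scale[OF vec_sub])
    moreover have "of_real s *s X = s *\<^sub>R X"
      by (simp add: vec_eq_iff scaleR_conv_of_real[where 'a = complex])
    ultimately show "s *\<^sub>R X \<in> ?L" by simp
  qed (use vec.subspace_0[OF vec_sub] vec.subspace_add[OF vec_sub] in auto)
  then obtain B where B: "B \<subseteq> ?L" "pairwise orthogonal B" "\<And>x. x \<in> B \<Longrightarrow> norm x = 1"
      "independent B" "span B = ?L"
    using orthonormal_basis_subspace by metis
  have finB: "finite B" using B(4) by (rule independent_imp_finite)
  have "\<exists>\<epsilon> \<delta>. \<epsilon> > 0 \<and> \<delta> > 0 \<and> (\<forall>z t. z \<in> nontangential_cone a \<nu> \<theta> \<longrightarrow> z \<in> ball a \<delta> \<longrightarrow> z \<noteq> a \<longrightarrow>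
      norm t < \<epsilon> \<longrightarrow> z + t *s b \<in> D)" if "b \<in> B" for b
  proof -
    have "b \<in> ?L" using that B(1) by blast
    from C1_boundary_disc_translate_along_cone[OF r aU openD this \<theta>] show ?thesis
      unfolding \<nu>_eq by metis
  qed
  then obtain \<epsilon> \<delta> where \<epsilon>\<delta>: "\<And>b. b \<in> B \<Longrightarrow> \<epsilon> b > 0" "\<And>b. b \<in> B \<Longrightarrow> \<delta> b > 0"
    "\<And>b z t. b \<in> B \<Longrightarrow> z \<in> nontangential_cone a \<nu> \<theta> \<Longrightarrow> z \<in> ball a (\<delta> b) \<Longrightarrow> z \<noteq> a \<Longrightarrow>
      norm t < \<epsilon> b \<Longrightarrow> z + t *s b \<in> D"
    by metis
  define K where "K = (\<Sum>b\<in>B. 1 / \<epsilon> b)"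
  have K: "K \<ge> 0" unfolding K_def using \<epsilon>\<delta>(1) by (intro sum_nonneg) (simp add: less_imp_le)
  \<comment> \<open>Inserting 1 keeps the minimum meaningful when the basis is empty.\<close>
  define \<delta>m where "\<delta>m = Min (insert 1 (\<delta> ` B))"
  have \<delta>m: "\<delta>m > 0" "\<And>b. b \<in> B \<Longrightarrow> \<delta>m \<le> \<delta> b"
    using finB \<epsilon>\<delta>(2) by (auto simp: \<delta>m_def)
  \<comment> \<open>\<open>K + 1\<close> avoids division by zero and makes the contradiction
    strict.\<close>
  define \<rho> where "\<rho> = 1 / (32 * (K + 1))"
  have \<rho>: "\<rho> > 0" using K by (simp add: \<rho>_def)
  show thesis
  proof (rule that[of "1 / \<rho>" \<delta>m])
    show "1 / \<rho> > 0" "\<delta>m > 0" using \<rho> \<delta>m by auto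
    fix z X assume z: "z \<in> D \<inter> nontangential_cone a \<nu> \<theta> \<inter> ball a \<delta>m"
      and X: "X \<in> ?L" "norm X = 1"
    have "z \<noteq> a" using z aD by auto
    have zb: "caratheodory_metric D z b \<le> ereal (1 / \<epsilon> b)" if "b \<in> B" for b
      by (rule caratheodory_metric_le_disc[OF \<epsilon>\<delta>(1)[OF that]], rule \<epsilon>\<delta>(3)[OF that])
         (use z \<open>z \<noteq> a\<close> \<delta>m(2)[OF that] in auto)
    have "caratheodory_metric D z (\<Sum>b\<in>B. (X \<bullet> b) *\<^sub>R b) \<le> ereal (\<Sum>b\<in>B. \<bar>X \<bullet> b\<bar> * (1 / \<epsilon> b))"
      by (rule caratheodory_metric_linear_combination_le) (use z zb in auto)
    also have "(\<Sum>b\<in>B. (X \<bullet> b) *\<^sub>R b) = X"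
      using X(1) B finB by (intro orthonormal_basis_expand) auto
    also have "(\<Sum>b\<in>B. \<bar>X \<bullet> b\<bar> * (1 / \<epsilon> b)) \<le> K"
      unfolding K_def
    proof (rule sum_mono)
      fix b assume b: "b \<in> B"
      have "\<bar>X \<bullet> b\<bar> \<le> 1" using Cauchy_Schwarz_ineq2[of X b] X(2) B(3)[OF b] by simp
      then show "\<bar>X \<bullet> b\<bar> * (1 / \<epsilon> b) \<le> 1 / \<epsilon> b"
        using \<epsilon>\<delta>(1)[OF b] by (intro mult_left_le_one_le) auto
    qed
    finally have cX: "caratheodory_metric D z X \<le> ereal K" by simp
    show "kobayashi_metric D z X \<le> ereal (1 / \<rho>)"
    proof (rule kobayashi_metric_le_disc[OF \<rho>], rule ccontr)
      fix t assume t: "norm t < \<rho>" "z + t *s X \<notin> D"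
      have "t \<noteq> 0" using t(2) z by auto
      then have "1 / (32 * norm t) > 1 / (32 * \<rho>)"
        using t(1) \<rho> by (intro divide_strict_left_mono) auto
      also have "1 / (32 * \<rho>) = K + 1" using K by (simp add: \<rho>_def)
      finally have "K < 1 / (32 * norm t)" by simp
      moreover have "ereal (1 / (32 * norm t)) \<le> ereal K"
        using C_convex_caratheodory_lower_bound[OF D _ t(2)] z cX by (meson IntD1 order_trans)
      ultimately show False by simp
    qed
  qed
qed

theorem proposition3:
  fixes D :: "(complex^'n) set" and a :: "complex^'n"
  assumes "C_convex_domain D" and "a \<in> frontier D"
  shows
    "(\<forall>X. X \<notin> boundary_disc_directions D a \<longrightarrow>
        (\<forall>M::real. M > 0 \<longrightarrow>
          (\<exists>U V. open U \<and> a \<in> U \<and> open V \<and> X \<in> V \<and>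
            (\<forall>z \<in> D \<inter> U. \<forall>Y \<in> V - boundary_disc_directions D a.
               caratheodory_metric D z Y > ereal M))))
     \<and>
     (C1_smooth_at D a \<longrightarrow>
        vec.subspace (boundary_disc_directions D a) \<and>
        (\<forall>\<nu> \<theta>. inner_unit_normal D a \<nu> \<longrightarrow> 0 < \<theta> \<longrightarrow> \<theta> < 1 \<longrightarrow>
          (\<exists>c::real. c > 0 \<and>
            (\<forall>X\<^sub>0 \<in> boundary_disc_directions D a. norm X\<^sub>0 = 1 \<longrightarrow>
              (\<forall>\<epsilon>::real. \<epsilon> > 0 \<longrightarrow>
                (\<exists>U V. open U \<and> a \<in> U \<and> open V \<and> X\<^sub>0 \<in> V \<and>
                  (\<forall>z \<in> D \<inter> nontangential_cone a \<nu> \<theta> \<inter> U.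
                    \<forall>X \<in> V \<inter> boundary_disc_directions D a. norm X = 1 \<longrightarrow>
                      kobayashi_metric D z X \<le> ereal (c + \<epsilon>))))))))"
proof (intro conjI impI allI)
  fix X and M :: real assume X: "X \<notin> boundary_disc_directions D a" "M > 0"
  obtain U V where "open U" "a \<in> U" "open V" "X \<in> V"
    "\<And>z Y. z \<in> D \<inter> U \<Longrightarrow> Y \<in> V \<Longrightarrow> caratheodory_metric D z Y > ereal M"
    using C_convex_caratheodory_tendsto_infinity[OF assms X] by blast
  then show "\<exists>U V. open U \<and> a \<in> U \<and> open V \<and> X \<in> V \<and>
      (\<forall>z \<in> D \<inter> U. \<forall>Y \<in> V - boundary_disc_directions D a. caratheodory_metric D z Y > ereal M)"
    by (intro exI[of _ U] exI[of _ V]) auto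
next
  assume "C1_smooth_at D a"
  then show "vec.subspace (boundary_disc_directions D a)"
    by (rule subspace_boundary_disc_directions[OF assms])
next
  fix \<nu> and \<theta> :: real
  assume \<nu>: "inner_unit_normal D a \<nu>" and \<theta>: "0 < \<theta>"
  obtain c \<delta> where c: "c > 0" "\<delta> > 0"
    "\<And>z X. z \<in> D \<inter> nontangential_cone a \<nu> \<theta> \<inter> ball a \<delta> \<Longrightarrow>
       X \<in> boundary_disc_directions D a \<Longrightarrow> norm X = 1 \<Longrightarrow> kobayashi_metric D z X \<le> ereal c"
    using C_convex_kobayashi_bounded_on_cone[OF assms \<nu> \<theta>] by blast
  have le: "kobayashi_metric D z X \<le> ereal (c + \<epsilon>)"
    if "z \<in> D \<inter> nontangential_cone a \<nu> \<theta> \<inter> ball a \<delta>" "X \<in> boundary_disc_directions D a"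
       "norm X = 1" "\<epsilon> > 0" for z X \<epsilon>
    using order_trans[OF c(3)[OF that(1-3)], of "ereal (c + \<epsilon>)"] that(4) by simp
  show "\<exists>c::real. c > 0 \<and>
            (\<forall>X\<^sub>0 \<in> boundary_disc_directions D a. norm X\<^sub>0 = 1 \<longrightarrow>
              (\<forall>\<epsilon>::real. \<epsilon> > 0 \<longrightarrow>
                (\<exists>U V. open U \<and> a \<in> U \<and> open V \<and> X\<^sub>0 \<in> V \<and>
                  (\<forall>z \<in> D \<inter> nontangential_cone a \<nu> \<theta> \<inter> U.
                    \<forall>X \<in> V \<inter> boundary_disc_directions D a. norm X = 1 \<longrightarrow>
                      kobayashi_metric D z X \<le> ereal (c + \<epsilon>)))))"
  proof (intro exI[of _ c] conjI ballI impI allI)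
    fix X\<^sub>0 and \<epsilon> :: real assume "\<epsilon> > 0"
    then show "\<exists>U V. open U \<and> a \<in> U \<and> open V \<and> X\<^sub>0 \<in> V \<and>
        (\<forall>z \<in> D \<inter> nontangential_cone a \<nu> \<theta> \<inter> U.
          \<forall>X \<in> V \<inter> boundary_disc_directions D a. norm X = 1 \<longrightarrow>
            kobayashi_metric D z X \<le> ereal (c + \<epsilon>))"
      \<comment> \<open>The bound is uniform over all unit vectors of \<open>L_a\<close>, so
        \<open>V\<close> can be the whole space.\<close>
      using c(2) by (intro exI[of _ "ball a \<delta>"] exI[of _ UNIV]) (auto intro!: le)
  qed (rule c(1))
qed

end
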